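(* Let $\mathcal{H}$ be a complex infinite-dimensional Hilbert space, let $n>1$ be an integer, and let $A\in B(\mathcal{H})$ satisfy $A^*A^n=A^nA^*$ (equivalently, $A^n$ is normal). Then $A$ satisfies a-generalized Weyl's theorem, i.e. $\sigma_a(A)\setminus\sigma_{uBw}(A)=E^a(A)$.
   Context: $\sigma_a(S)$ is the approximate point spectrum and $\sigma_p(S)$ the point spectrum of $S\in B(\mathcal{H})$. $E^a(S)=\{\lambda:\lambda\text{ is an isolated point of }\sigma_a(S)\text{ and }\lambda\in\sigma_p(S)\}$. An operator $T\in B(\mathcal{H})$ is upper semi-B-Fredholm if for some integer $m\ge0$ the range $T^m(\mathcal{H})$ is closed and the restriction $T_m$ of $T$ to $T^m(\mathcal{H})$ is upper semi-Fredholm (closed range and finite-dimensional kernel); its index is defined as the index of $T_m$. $T$ is upper semi-B-Weyl if it is upper semi-B-Fredholm with index $\le0$. The upper B-Weyl spectrum is $\sigma_{uBw}(S)=\{\lambda\in\mathbb{C}: S-\lambda\text{ is not upper semi-B-Weyl}\}$. *)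

theory Defs
  imports "HOL-Analysis.Analysis"
begin

class complex_hilbert = banach +
  fixes scaleC :: "complex \<Rightarrow> 'a \<Rightarrow> 'a"
    and cinner :: "'a \<Rightarrow> 'a \<Rightarrow> complex"
  assumes scaleC_add_right: "scaleC a (x + y) = scaleC a x + scaleC a y"
    and scaleC_add_left: "scaleC (a + b) x = scaleC a x + scaleC b x"
    and scaleC_scaleC: "scaleC a (scaleC b x) = scaleC (a * b) x"
    and scaleC_one: "scaleC 1 x = x"
    and scaleR_scaleC: "scaleR r x = scaleC (complex_of_real r) x"
    and cinner_add_left: "cinner (x + y) z = cinner x z + cinner y z"
    and cinner_scaleC_left: "cinner (scaleC a x) y = cnj a * cinner x y"
    and cinner_commute: "cinner y x = cnj (cinner x y)"
    and cinner_ge_zero: "0 \<le> Re (cinner x x)"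
    and cinner_eq_zero_iff: "cinner x x = 0 \<longleftrightarrow> x = 0"
    and norm_eq_sqrt_cinner: "norm x = sqrt (Re (cinner x x))"

definition cspan :: "'a::complex_hilbert set \<Rightarrow> 'a set" where
  "cspan F = {y. \<exists>G c. finite G \<and> G \<subseteq> F \<and> y = (\<Sum>x\<in>G. scaleC (c x) x)}"

definition infinite_dimensional :: "'a::complex_hilbert itself \<Rightarrow> bool" where
  "infinite_dimensional _ \<longleftrightarrow> \<not> (\<exists>F::'a set. finite F \<and> cspan F = UNIV)"

text \<open>Algebraic codimension of (the span of) M inside the subspace R: the least number
of vectors of R needed together with M to span R; \<infinity> if no finite number suffices.
With M = {} this is the (complex) dimension of R.\<close>
definition rel_cdim :: "'a::complex_hilbert set \<Rightarrow> 'a set \<Rightarrow> enat" where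
  "rel_cdim M R =
     (if \<exists>F. finite F \<and> F \<subseteq> R \<and> R \<subseteq> cspan (M \<union> F)
      then enat (LEAST n. \<exists>F. finite F \<and> card F = n \<and> F \<subseteq> R \<and> R \<subseteq> cspan (M \<union> F))
      else \<infinity>)"

definition cdim :: "'a::complex_hilbert set \<Rightarrow> enat" where
  "cdim R = rel_cdim {} R"

definition bounded_op :: "('a::complex_hilbert \<Rightarrow> 'a) \<Rightarrow> bool" where
  "bounded_op T \<longleftrightarrow> (\<forall>x y. T (x + y) = T x + T y) \<and> (\<forall>c x. T (scaleC c x) = scaleC c (T x))
     \<and> (\<exists>K. \<forall>x. norm (T x) \<le> K * norm x)"

definition op_adjoint :: "('a::complex_hilbert \<Rightarrow> 'a) \<Rightarrow> ('a \<Rightarrow> 'a)" where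
  "op_adjoint T = (THE S. \<forall>x y. cinner (T x) y = cinner x (S y))"

definition shift_op :: "('a::complex_hilbert \<Rightarrow> 'a) \<Rightarrow> complex \<Rightarrow> 'a \<Rightarrow> 'a" where
  "shift_op T l = (\<lambda>x. T x - scaleC l x)"

definition approx_point_spectrum :: "('a::complex_hilbert \<Rightarrow> 'a) \<Rightarrow> complex set" where
  "approx_point_spectrum S = {l. \<exists>x::nat \<Rightarrow> 'a. (\<forall>k. norm (x k) = 1) \<and>
       (\<lambda>k. shift_op S l (x k)) \<longlonglongrightarrow> 0}"

definition point_spectrum :: "('a::complex_hilbert \<Rightarrow> 'a) \<Rightarrow> complex set" where
  "point_spectrum S = {l. \<exists>x. x \<noteq> 0 \<and> S x = scaleC l x}"

definition Ea :: "('a::complex_hilbert \<Rightarrow> 'a) \<Rightarrow> complex set" where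
  "Ea S = {l. l isolated_in approx_point_spectrum S \<and> l \<in> point_spectrum S}"

text \<open>Upper semi-B-Weyl: for some m, R = T^m(H) is closed and the restriction T_m of T to R
is upper semi-Fredholm (T(R) closed, ker T_m = ker T \<inter> R finite-dimensional) with index
dim ker T_m - codim_R T(R) \<le> 0 (index = -\<infinity> when the codimension is infinite).\<close>
definition upper_semi_B_Weyl :: "('a::complex_hilbert \<Rightarrow> 'a) \<Rightarrow> bool" where
  "upper_semi_B_Weyl T \<longleftrightarrow> (\<exists>m. let R = range (T ^^ m); K = {x \<in> R. T x = 0} in
      closed R \<and> closed (T ` R) \<and> cdim K \<noteq> \<infinity> \<and> cdim K \<le> rel_cdim (T ` R) R)"

definition upper_B_Weyl_spectrum :: "('a::complex_hilbert \<Rightarrow> 'a) \<Rightarrow> complex set" where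
  "upper_B_Weyl_spectrum S = {l. \<not> upper_semi_B_Weyl (shift_op S l)}"

end

theory Submission
  imports Defs
begin

text \<open>Write \<open>N = A\<^sup>n\<close>, a normal operator commuting with \<open>A\<close> and \<open>A\<^sup>*\<close>. The eigenspace
  \<open>M = ker (N - l\<^sup>n)\<close> reduces \<open>A\<close>; on \<open>M\<close> the operator \<open>A\<close> is algebraic, and on \<open>M\<^sup>\<bottom>\<close> the
  operator \<open>T = A - l\<close> is injective with dense range. If some \<open>T\<^sup>m\<^sup>+\<^sup>1\<close> has closed range, then \<open>T\<close> is
  invertible on \<open>M\<^sup>\<bottom>\<close>, so \<open>l\<close> is isolated in the approximate point spectrum, and it is an eigenvalue because
  otherwise \<open>T\<close> would be bounded below on \<open>M\<close> as well.

  Conversely, let \<open>l\<close> be isolated. If \<open>T\<^sup>*T\<close> (for \<open>l = 0\<close>: \<open>N\<^sup>*N\<close>) had arbitrarily small approximate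
  eigenvalues \<open>c > 0\<close>, then, as it commutes with \<open>N\<close>, there would be joint approximate eigenvectors
  for \<open>c\<close> and some \<open>w\<close> close to \<open>l\<^sup>n\<close>. An \<open>n\<close>-th root of \<open>w\<close> close to \<open>l\<close> then lies in the
  approximate point spectrum of \<open>A\<close>, so it is \<open>l\<close>; but \<open>w = l\<^sup>n\<close> is incompatible with a small
  \<open>c > 0\<close>. Hence \<open>T\<^sup>*T\<close> has a spectral gap above 0, \<open>T\<close> is bijective on \<open>M\<^sup>\<bottom>\<close>, and a power of \<open>T\<close>
  has closed range on which \<open>T\<close> is bijective.\<close>

section \<open>Hilbert space preliminaries\<close>

global_interpretation scaleC: vector_space "scaleC :: complex \<Rightarrow> 'a \<Rightarrow> 'a::complex_hilbert"
  by unfold_locales (simp_all add: scaleC_add_right scaleC_add_left scaleC_scaleC scaleC_one)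

text \<open>The real part determines the norm and makes H a real inner product space, to which
  \<open>bilinear\<close>, \<open>subspace\<close> and \<open>bounded_linear\<close> apply directly.
  Against complex subspaces, such as the kernels of the operators below, real and complex
  orthogonality agree.\<close>

definition rip :: "'a::complex_hilbert \<Rightarrow> 'a \<Rightarrow> real" where
  "rip x y = Re (cinner x y)"

lemma cinner_add_right: "cinner z (x + y) = cinner z x + cinner z (y :: 'a::complex_hilbert)"
  by (metis cinner_add_left cinner_commute complex_cnj_add)

lemma cinner_scaleC_right: "cinner x (scaleC a y) = a * cinner x (y :: 'a::complex_hilbert)"
  by (metis cinner_commute cinner_scaleC_left complex_cnj_cnj complex_cnj_mult)

lemma rip_commute: "rip x y = rip y x"
  unfolding rip_def by (subst cinner_commute) simp

lemma rip_add_left: "rip (x + y) z = rip x z + rip y z"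
  by (simp add: rip_def cinner_add_left)

lemma rip_scaleR_left: "rip (r *\<^sub>R x) y = r * rip x y"
  by (simp add: rip_def scaleR_scaleC cinner_scaleC_left)

lemma rip_add_right: "rip z (x + y) = rip z x + rip z y"
  by (simp add: rip_def cinner_add_right)

lemma rip_scaleR_right: "rip x (r *\<^sub>R y) = r * rip x y"
  by (simp add: rip_def scaleR_scaleC cinner_scaleC_right)

lemma bilinear_rip: "bilinear rip"
  by (simp add: bilinear_def linear_iff rip_add_left rip_scaleR_left rip_add_right rip_scaleR_right)

lemmas rip_simps =
  bilinear_ladd[OF bilinear_rip] bilinear_radd[OF bilinear_rip]
  bilinear_lsub[OF bilinear_rip] bilinear_rsub[OF bilinear_rip]
  bilinear_lneg[OF bilinear_rip] bilinear_rneg[OF bilinear_rip]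
  bilinear_lzero[OF bilinear_rip] bilinear_rzero[OF bilinear_rip]
  bilinear_lmul[OF bilinear_rip] bilinear_rmul[OF bilinear_rip]

lemma rip_self: "rip x x = (norm x)\<^sup>2"
  by (simp add: rip_def norm_eq_sqrt_cinner cinner_ge_zero)

lemma rip_scaleC_left: "rip (scaleC a x) y = rip x (scaleC (cnj a) y)"
  by (simp add: rip_def cinner_scaleC_left cinner_scaleC_right)

text \<open>Multiplying \<open>y\<close> by i turns the imaginary part, up to sign, into a real
  part, so identities for \<open>rip\<close> lift to the product \<open>cinner\<close> that defines
  \<open>op_adjoint\<close>.\<close>

lemma cinner_conv_rip: "cinner x y = Complex (rip x y) (- rip x (scaleC \<i> y))"
  by (simp add: rip_def cinner_scaleC_right complex_eq_iff)

lemma norm_scaleC: "norm (scaleC a x) = cmod a * norm (x :: 'a::complex_hilbert)"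
proof -
  have "(norm (scaleC a x))\<^sup>2 = (cmod a * norm x)\<^sup>2"
    unfolding rip_self[symmetric] rip_scaleC_left scaleC_scaleC power_mult_distrib
    by (metis complex_norm_square complex_mod_cnj mult.commute of_real_power rip_simps(10) 
        scaleR_scaleC real_scaleR_def)
  then show ?thesis
    by (simp add: power2_eq_iff_nonneg)
qed

text \<open>The quadratic t |-> b (x + t y) (x + t y) is never negative. Semidefiniteness is the
  right generality because the form \<open>rip (Q x) y\<close> of a positive operator Q is treated
  this way later.\<close>

lemma semidefinite_cauchy_schwarz:
  fixes b :: "'v::real_vector \<Rightarrow> 'v \<Rightarrow> real"
  assumes "bilinear b" and sym: "\<And>x y. b x y = b y x" and pos: "\<And>x. 0 \<le> b x x"
  shows "(b x y)\<^sup>2 \<le> b x x * b y y"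
proof -
  have q: "0 \<le> b x x + 2 * t * b x y + t\<^sup>2 * b y y" for t
    using pos[of "x + t *\<^sub>R y"] sym[of y x]
    by (simp add: bilinear_ladd[OF assms(1)] bilinear_radd[OF assms(1)] bilinear_lmul[OF assms(1)]
        bilinear_rmul[OF assms(1)] power2_eq_square algebra_simps)
  show ?thesis
  proof (cases "b y y = 0")
    case True
    have "b x y = 0"
    proof (rule ccontr)
      assume "b x y \<noteq> 0"
      then show False
        \<comment> \<open>With \<open>b y y = 0\<close> the bound is affine in t, and this t gives
          it the value -1.\<close>
        using q[of "- (b x x + 1) / (2 * b x y)"] True by (simp add: field_simps)
    qed
    then show ?thesis using True by simp
  next
    case False
    with pos have "b y y > 0" by (simp add: less_le)
    then show ?thesis
      \<comment> \<open>This t minimises the quadratic.\<close>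
      using q[of "- b x y / b y y"]
      by (simp add: field_simps power2_eq_square)
  qed
qed

lemma rip_cauchy_schwarz: "\<bar>rip x y\<bar> \<le> norm x * norm y"
proof -
  have "(rip x y)\<^sup>2 \<le> (norm x * norm y)\<^sup>2"
    using semidefinite_cauchy_schwarz[OF bilinear_rip rip_commute, of x y]
    by (simp add: rip_self power_mult_distrib)
  then show ?thesis
    by (metis abs_le_square_iff abs_mult abs_norm_cancel)
qed

lemma bounded_bilinear_rip: "bounded_bilinear rip"
  by (rule bounded_bilinear.intro) (auto simp: rip_simps intro!: exI[of _ 1] rip_cauchy_schwarz)

lemma norm_add_squared: "(norm (x + y))\<^sup>2 = (norm x)\<^sup>2 + 2 * rip x y + (norm y)\<^sup>2"
  by (simp add: rip_self[symmetric] rip_simps rip_commute[of y x])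

lemma norm_diff_squared: "(norm (x - y))\<^sup>2 = (norm x)\<^sup>2 - 2 * rip x y + (norm y)\<^sup>2"
  by (simp add: rip_self[symmetric] rip_simps rip_commute[of y x])

text \<open>Projection onto M: the parallelogram law makes a sequence in M whose distances to x tend
  to \<open>infdist x M\<close> a Cauchy sequence, and first-order variation at its limit gives
  orthogonality.\<close>

lemma orthogonal_decomposition:
  fixes M :: "'a::complex_hilbert set"
  assumes "closed M" "subspace M"
  obtains u v where "x = u + v" "u \<in> M" "\<And>y. y \<in> M \<Longrightarrow> rip y v = 0"
proof -
  define d where "d = infdist x M"
  have ne: "M \<noteq> {}" using subspace_0[OF assms(2)] by auto
  have d_le: "d \<le> norm (x - y)" if "y \<in> M" for y
    unfolding d_def using infdist_le[OF that, of x] by (simp add: dist_norm)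
  have d0: "d \<ge> 0" unfolding d_def by (rule infdist_nonneg)
  have "\<exists>y\<in>M. norm (x - y) < d + 1 / Suc k" for k :: nat
  proof -
    have "(INF y\<in>M. dist x y) < d + 1 / Suc k"
      unfolding d_def infdist_notempty[OF ne] by simp
    then show ?thesis
      by (subst (asm) cINF_less_iff[OF ne]) (auto simp: dist_norm bdd_below_def intro!: exI[of _ 0])
  qed
  then obtain s where s: "\<And>k. s k \<in> M" "\<And>k. norm (x - s k) < d + 1 / Suc k"
    by metis
  have gap: "(norm (s j - s k))\<^sup>2 \<le> 2 * (d + 1 / Suc m)\<^sup>2 + 2 * (d + 1 / Suc m)\<^sup>2 - 4 * d\<^sup>2"
    if "m \<le> j" "m \<le> k" for j k m
  proof -
    have par: "(norm (s j - s k))\<^sup>2 + (norm (2 *\<^sub>R (x - (1/2) *\<^sub>R (s j + s k))))\<^sup>2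
        = 2 * (norm (x - s j))\<^sup>2 + 2 * (norm (x - s k))\<^sup>2"
      by (simp add: rip_self[symmetric] rip_simps algebra_simps
          rip_commute[of "s k" "s j"] rip_commute[of x "s j"] rip_commute[of x "s k"])
    \<comment> \<open>The midpoint of two members of M lies in M, so its distance to x is at least
      d; this bounds the second term of the parallelogram law from below.\<close>
    have "d \<le> norm (x - (1/2) *\<^sub>R (s j + s k))"
      by (intro d_le subspace_mul subspace_add assms s)
    then have "4 * d\<^sup>2 \<le> (norm (2 *\<^sub>R (x - (1/2) *\<^sub>R (s j + s k))))\<^sup>2"
      using d0 by (simp add: power_mult_distrib power_mono)
    moreover have near: "(norm (x - s i))\<^sup>2 \<le> (d + 1 / Suc m)\<^sup>2" if "m \<le> i" for i
    proof -
      have "1 / real (Suc i) \<le> 1 / real (Suc m)"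
        using that by (simp add: field_simps)
      then show ?thesis
        using s(2)[of i] by (intro power_mono) auto
    qed
    ultimately show ?thesis using par near[OF that(1)] near[OF that(2)] by linarith
  qed
  have lim: "(\<lambda>m. 2 * (d + 1 / Suc m)\<^sup>2 + 2 * (d + 1 / Suc m)\<^sup>2 - 4 * d\<^sup>2) \<longlonglongrightarrow> 0"
  proof -
    have "(\<lambda>m. 2 * (d + 1 / Suc m)\<^sup>2 + 2 * (d + 1 / Suc m)\<^sup>2 - 4 * d\<^sup>2)
       \<longlonglongrightarrow> 2 * (d + 0)\<^sup>2 + 2 * (d + 0)\<^sup>2 - 4 * d\<^sup>2"
      by (intro tendsto_intros LIMSEQ_Suc[OF lim_1_over_n])
    then show ?thesis by simp
  qed
  have "Cauchy s"
  proof (rule metric_CauchyI)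
    fix e :: real assume "e > 0"
    then have "\<forall>\<^sub>F m in sequentially. 2 * (d + 1 / Suc m)\<^sup>2 + 2 * (d + 1 / Suc m)\<^sup>2 - 4 * d\<^sup>2 < e\<^sup>2"
      by (intro order_tendstoD(2)[OF lim]) simp
    then obtain m where m: "2 * (d + 1 / Suc m)\<^sup>2 + 2 * (d + 1 / Suc m)\<^sup>2 - 4 * d\<^sup>2 < e\<^sup>2"
      by (auto simp: eventually_sequentially)
    have "dist (s j) (s k) < e" if "m \<le> j" "m \<le> k" for j k
      using gap[OF that] m \<open>e > 0\<close> unfolding dist_norm
      by (meson less_imp_le order_le_less_trans power_less_imp_less_base)
    then show "\<exists>m. \<forall>j\<ge>m. \<forall>k\<ge>m. dist (s j) (s k) < e" by blast
  qed
  then obtain u where u: "s \<longlonglongrightarrow> u"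
    using Cauchy_convergent convergent_def by blast
  have uM: "u \<in> M"
    using closed_sequentially[OF assms(1) s(1) u] .
  have "norm (x - u) \<le> d"
  proof (rule LIMSEQ_le)
    show "(\<lambda>k. norm (x - s k)) \<longlonglongrightarrow> norm (x - u)"
      by (intro tendsto_intros u)
    show "(\<lambda>k. d + 1 / Suc k) \<longlonglongrightarrow> d"
      using tendsto_add[OF tendsto_const LIMSEQ_Suc[OF lim_1_over_n], of d] by simp
    show "\<exists>N. \<forall>k\<ge>N. norm (x - s k) \<le> d + 1 / Suc k"
      using s(2) less_imp_le by blast
  qed
  have "rip y (x - u) = 0" if y: "y \<in> M" for y
  proof -
    define c where "c = rip (x - u) y"
    have ineq: "0 \<le> t\<^sup>2 * (norm y)\<^sup>2 - 2 * t * c" for t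
    proof -
      have "norm (x - u) \<le> norm (x - (u + t *\<^sub>R y))"
        using \<open>norm (x - u) \<le> d\<close> d_le[of "u + t *\<^sub>R y"] y uM assms(2)
        by (meson order_trans subspace_add subspace_mul)
      then have "(norm (x - u))\<^sup>2 \<le> (norm ((x - u) - t *\<^sub>R y))\<^sup>2"
        by (simp add: diff_diff_eq power_mono)
      then show ?thesis
        unfolding norm_diff_squared[of "x - u" "t *\<^sub>R y"] c_def
        by (simp add: rip_simps power_mult_distrib)
    qed
    have "c = 0"
    proof (cases "y = 0")
      case True
      then show ?thesis by (simp add: c_def rip_simps)
    next
      case False
      then show ?thesis
        \<comment> \<open>The minimising t yields -c^2 divided by the squared norm of y, which has
          to be nonnegative.\<close>
        using ineq[of "c / (norm y)\<^sup>2"]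
        by (simp add: field_simps power2_eq_square)
          (metis mult_eq_0_iff not_square_less_zero order_le_less)
    qed
    then show ?thesis unfolding c_def by (simp add: rip_commute)
  qed
  then show ?thesis
    using that[of u "x - u"] uM by simp
qed


text \<open>A vector w orthogonal to the kernel of f and outside it represents f up to a scalar,
  because x - (f x / f w) w always lies in the kernel.\<close>

lemma riesz_representation:
  fixes f :: "'a::complex_hilbert \<Rightarrow> real"
  assumes "bounded_linear f"
  obtains v where "\<And>x. f x = rip x v"
proof (cases "\<forall>x. f x = 0")
  case True
  then show ?thesis using that[of 0] by (simp add: rip_simps)
next
  case False
  interpret bounded_linear f by fact
  obtain x0 where x0: "f x0 \<noteq> 0" using False by blast
  have "closed {x. f x = 0}"
    by (intro closed_Collect_eq continuous_intros linear_continuous_on assms)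
  moreover have "subspace {x. f x = 0}"
    by (simp add: subspace_def add scale)
  ultimately obtain u w where uw: "x0 = u + w" "f u = 0" "\<And>y. f y = 0 \<Longrightarrow> rip y w = 0"
    by (rule orthogonal_decomposition[of "{x. f x = 0}" x0]) auto
  have fw: "f w \<noteq> 0" using x0 uw by (simp add: add)
  then have w: "norm w \<noteq> 0" by auto
  have "f x = rip x ((f w / (norm w)\<^sup>2) *\<^sub>R w)" for x
  proof -
    have "rip (x - (f x / f w) *\<^sub>R w) w = 0"
      using fw by (intro uw(3)) (simp add: diff scale)
    then have "rip x w = f x / f w * (norm w)\<^sup>2"
      by (simp add: rip_simps rip_self)
    then show ?thesis using fw w by (simp add: rip_simps)
  qed
  then show ?thesis by (rule that)
qed

section \<open>Bounded operators, adjoints and uniform boundedness\<close>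

lemma bounded_op_iff:
  "bounded_op T \<longleftrightarrow> bounded_linear T \<and> (\<forall>c x. T (scaleC c x) = scaleC c (T x))"
proof
  assume T: "bounded_op T"
  then obtain K where "\<And>x. norm (T x) \<le> K * norm x"
    unfolding bounded_op_def by blast
  then have "bounded_linear T"
    using T unfolding bounded_op_def
    by (intro bounded_linear_intro[where K = K]) (auto simp: scaleR_scaleC mult.commute)
  then show "bounded_linear T \<and> (\<forall>c x. T (scaleC c x) = scaleC c (T x))"
    using T unfolding bounded_op_def by blast
next
  assume T: "bounded_linear T \<and> (\<forall>c x. T (scaleC c x) = scaleC c (T x))"
  then interpret bounded_linear T by blast
  show "bounded_op T"
    using T bounded unfolding bounded_op_def by (auto simp: add mult.commute)
qed

lemma bounded_op_bounded_linear: "bounded_op T \<Longrightarrow> bounded_linear T"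
  by (simp add: bounded_op_iff)

lemma bounded_op_scaleC: "bounded_op T \<Longrightarrow> T (scaleC c x) = scaleC c (T x)"
  by (simp add: bounded_op_iff)

lemmas bounded_op_linear_simps =
  linear_add[OF bounded_linear.linear[OF bounded_op_bounded_linear]]
  linear_diff[OF bounded_linear.linear[OF bounded_op_bounded_linear]]
  linear_neg[OF bounded_linear.linear[OF bounded_op_bounded_linear]]
  linear_0[OF bounded_linear.linear[OF bounded_op_bounded_linear]]
  linear_scale[OF bounded_linear.linear[OF bounded_op_bounded_linear]]
  bounded_op_scaleC

lemma bounded_op_bound:
  assumes "bounded_op T"
  obtains K where "K > 0" "\<And>x. norm (T x) \<le> K * norm x"
  using bounded_linear.pos_bounded[OF bounded_op_bounded_linear[OF assms]] by (auto simp: mult.commute)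

lemma bounded_linear_scaleC: "bounded_linear (scaleC c :: 'a \<Rightarrow> 'a::complex_hilbert)"
  by (rule bounded_linear_intro[where K = "cmod c"])
    (auto simp: scaleC_add_right scaleR_scaleC scaleC_scaleC norm_scaleC mult.commute)

lemma bounded_op_id [simp]: "bounded_op (\<lambda>x. x)"
  by (simp add: bounded_op_iff bounded_linear_ident)

lemma bounded_op_zero [simp]: "bounded_op (\<lambda>x. 0)"
  by (simp add: bounded_op_iff bounded_linear_zero)

lemma bounded_op_compose: "bounded_op S \<Longrightarrow> bounded_op T \<Longrightarrow> bounded_op (\<lambda>x. S (T x))"
  by (simp add: bounded_op_iff bounded_linear_compose)

lemma bounded_op_add: "bounded_op S \<Longrightarrow> bounded_op T \<Longrightarrow> bounded_op (\<lambda>x. S x + T x)"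
  by (simp add: bounded_op_iff bounded_linear_add scaleC_add_right)

lemma bounded_op_diff: "bounded_op S \<Longrightarrow> bounded_op T \<Longrightarrow> bounded_op (\<lambda>x. S x - T x)"
  by (simp add: bounded_op_iff bounded_linear_sub scaleC.scale_right_diff_distrib)

lemma bounded_op_scaleC_compose: "bounded_op T \<Longrightarrow> bounded_op (\<lambda>x. scaleC c (T x))"
  by (simp add: bounded_op_iff bounded_linear_compose[OF bounded_linear_scaleC] scaleC_scaleC mult.commute)

lemma bounded_op_sum: "(\<And>i. i \<in> I \<Longrightarrow> bounded_op (T i)) \<Longrightarrow> bounded_op (\<lambda>x. \<Sum>i\<in>I. T i x)"
  by (simp add: bounded_op_iff bounded_linear_sum scaleC.scale_sum_right)

lemma bounded_op_funpow: "bounded_op T \<Longrightarrow> bounded_op (T ^^ k)"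
  by (induction k) (simp_all add: id_def o_def bounded_op_compose)

lemma bounded_op_shift: "bounded_op T \<Longrightarrow> bounded_op (shift_op T l)"
  unfolding shift_op_def by (intro bounded_op_diff bounded_op_scaleC_compose bounded_op_id)

text \<open>A relation in place of the definite description \<open>op_adjoint\<close>: it passes to
  sums, products and shifts, and \<open>adjoint_pair Q Q\<close> expresses self-adjointness. As both
  maps are complex linear, the identity for \<open>rip\<close> entails the one for
  \<open>cinner\<close>.\<close>

definition adjoint_pair :: "('a::complex_hilbert \<Rightarrow> 'a) \<Rightarrow> ('a \<Rightarrow> 'a) \<Rightarrow> bool" where
  "adjoint_pair S T \<longleftrightarrow> bounded_op S \<and> bounded_op T \<and> (\<forall>x y. rip (S x) y = rip x (T y))"

lemma adjoint_pairD:
  assumes "adjoint_pair S T"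
  shows "bounded_op S" "bounded_op T" "rip (S x) y = rip x (T y)" "rip (T x) y = rip x (S y)"
  using assms unfolding adjoint_pair_def by (metis rip_commute)+

lemma adjoint_pair_sym: "adjoint_pair S T \<Longrightarrow> adjoint_pair T S"
  using adjoint_pairD unfolding adjoint_pair_def by metis

lemma adjoint_pair_id: "adjoint_pair (\<lambda>x. x) (\<lambda>x. x)"
  by (simp add: adjoint_pair_def)

lemma adjoint_pair_compose:
  "adjoint_pair S S' \<Longrightarrow> adjoint_pair T T' \<Longrightarrow> adjoint_pair (\<lambda>x. S (T x)) (\<lambda>x. T' (S' x))"
  unfolding adjoint_pair_def by (simp add: bounded_op_compose)

lemma adjoint_pair_add:
  "adjoint_pair S S' \<Longrightarrow> adjoint_pair T T' \<Longrightarrow> adjoint_pair (\<lambda>x. S x + T x) (\<lambda>x. S' x + T' x)"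
  unfolding adjoint_pair_def by (simp add: bounded_op_add rip_simps)

lemma adjoint_pair_diff:
  "adjoint_pair S S' \<Longrightarrow> adjoint_pair T T' \<Longrightarrow> adjoint_pair (\<lambda>x. S x - T x) (\<lambda>x. S' x - T' x)"
  unfolding adjoint_pair_def by (simp add: bounded_op_diff rip_simps)

lemma adjoint_pair_scaleC:
  "adjoint_pair S S' \<Longrightarrow> adjoint_pair (\<lambda>x. scaleC c (S x)) (\<lambda>x. scaleC (cnj c) (S' x))"
  unfolding adjoint_pair_def by (simp add: bounded_op_scaleC_compose rip_scaleC_left bounded_op_scaleC)

lemma adjoint_pair_scaleR:
  "adjoint_pair S S' \<Longrightarrow> adjoint_pair (\<lambda>x. r *\<^sub>R S x) (\<lambda>x. r *\<^sub>R S' x)"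
  using adjoint_pair_scaleC[of S S' "of_real r"] by (simp add: scaleR_scaleC)

lemma adjoint_pair_funpow: "adjoint_pair S S' \<Longrightarrow> adjoint_pair (S ^^ k) (S' ^^ k)"
proof (induction k)
  case 0
  then show ?case by (simp add: id_def adjoint_pair_id)
next
  case (Suc k)
  then have "adjoint_pair (\<lambda>x. S ((S ^^ k) x)) (\<lambda>x. (S' ^^ k) (S' x))"
    using adjoint_pair_compose[of S S' "S ^^ k" "S' ^^ k"] by blast
  then show ?case
    by (simp add: o_def funpow_swap1)
qed

lemma adjoint_pair_shift: "adjoint_pair S S' \<Longrightarrow> adjoint_pair (shift_op S l) (shift_op S' (cnj l))"
  unfolding shift_op_def
  by (intro adjoint_pair_diff adjoint_pair_scaleC adjoint_pair_id)

text \<open>Riesz representation yields the adjoint pointwise; nondegeneracy of \<open>rip\<close>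
  makes it unique, linear and equal to the map described by \<open>op_adjoint\<close>.\<close>

lemma op_adjoint_pair:
  fixes T :: "'a::complex_hilbert \<Rightarrow> 'a"
  assumes T: "bounded_op T"
  shows "adjoint_pair T (op_adjoint T)"
proof -
  obtain K where K: "K > 0" "\<And>x. norm (T x) \<le> K * norm x"
    using bounded_op_bound[OF T] by blast
  have "\<exists>v. \<forall>x. rip (T x) y = rip x v" for y
  proof -
    have "bounded_linear (\<lambda>x. rip (T x) y)"
      by (intro bounded_linear_compose[OF bounded_bilinear.bounded_linear_left[OF bounded_bilinear_rip]]
          bounded_op_bounded_linear T)
    then show ?thesis
      using riesz_representation by metis
  qed
  then obtain S where S: "\<And>x y. rip (T x) y = rip x (S y)" by metis
  have ext: "u = v" if "\<And>x. rip x u = rip x v" for u v :: 'a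
  proof -
    have "rip (u - v) (u - v) = 0"
      using that[of "u - v"] by (simp add: rip_simps(4))
    then show ?thesis by (simp add: rip_self)
  qed
  have cadj: "cinner (T x) y = cinner x (S y)" for x y
  proof -
    have "rip (T x) (scaleC \<i> y) = rip x (scaleC \<i> (S y))"
      \<comment> \<open>Testing at -i x transfers the identity to the imaginary parts.\<close>
      using S[of "scaleC (- \<i>) x" y]
      by (simp add: bounded_op_linear_simps[OF T] rip_scaleC_left rip_simps)
    then show ?thesis by (simp add: cinner_conv_rip S)
  qed
  have uniq: "S' = S" if "\<forall>x y. cinner (T x) y = cinner x (S' y)" for S'
  proof
    fix y
    have "rip x (S' y) = rip x (S y)" for x
      using that cadj by (metis rip_def)
    then show "S' y = S y" by (rule ext)
  qed
  have "op_adjoint T = S"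
    unfolding op_adjoint_def by (rule the_equality) (use cadj uniq in blast)+
  moreover have "bounded_op S"
  proof -
    have add: "S (x + y) = S x + S y" for x y
      by (rule ext) (simp add: rip_simps S[symmetric])
    have scale: "S (scaleC c x) = scaleC c (S x)" for c x
    proof (rule ext)
      fix z
      have "rip z (S (scaleC c x)) = rip (T (scaleC (cnj c) z)) x"
        by (simp add: S[symmetric] bounded_op_scaleC[OF T] rip_scaleC_left)
      then show "rip z (S (scaleC c x)) = rip z (scaleC c (S x))"
        by (simp add: S rip_scaleC_left)
    qed
    have "norm (S y) \<le> K * norm y" for y
    proof -
      have "(norm (S y))\<^sup>2 = rip (T (S y)) y"
        by (simp add: S rip_self)
      also have "\<dots> \<le> norm (T (S y)) * norm y"
        using rip_cauchy_schwarz[of "T (S y)" y] by linarith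
      also have "\<dots> \<le> (K * norm (S y)) * norm y"
        by (intro mult_right_mono K) auto
      finally have "norm (S y) * norm (S y) \<le> norm (S y) * (K * norm y)"
        by (simp add: power2_eq_square algebra_simps)
      then show ?thesis
        using K(1) by (cases "norm (S y) = 0") auto
    qed
    then show ?thesis
      unfolding bounded_op_def using add scale by blast
  qed
  ultimately show ?thesis
    unfolding adjoint_pair_def using S T by simp
qed

text \<open>The uniform boundedness principle for the functionals \<open>rip x v\<close> with v in
  B, from Baire's theorem. It is the source of the bounded inverse theorem below.\<close>

lemma weakly_bounded_imp_bounded:
  fixes B :: "'a::complex_hilbert set"
  assumes "\<And>x. \<exists>c. \<forall>v\<in>B. \<bar>rip x v\<bar> \<le> c"
  obtains C where "\<And>v. v \<in> B \<Longrightarrow> norm v \<le> C"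
proof -
  define F where "F k = {x. \<forall>v\<in>B. \<bar>rip x v\<bar> \<le> real k}" for k :: nat
  have clF: "closed (F k)" for k
  proof -
    have "closed {x. \<bar>rip x v\<bar> \<le> real k}" for v
      by (intro closed_Collect_le continuous_intros linear_continuous_on
          bounded_bilinear.bounded_linear_left[OF bounded_bilinear_rip])
    moreover have "F k = (\<Inter>v\<in>B. {x. \<bar>rip x v\<bar> \<le> real k})"
      by (auto simp: F_def)
    ultimately show ?thesis by auto
  qed
  have cover: "\<Union>(range F) = UNIV"
  proof -
    have "\<exists>k. x \<in> F k" for x
    proof -
      obtain c where c: "\<And>v. v \<in> B \<Longrightarrow> \<bar>rip x v\<bar> \<le> c" using assms by blast
      obtain k where "c \<le> real k" using real_arch_simple by blast
      then have "x \<in> F k" using c order_trans unfolding F_def by blast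
      then show ?thesis ..
    qed
    then show ?thesis by auto
  qed
  have "\<exists>k. interior (F k) \<noteq> {}"
  proof (rule ccontr)
    assume "\<nexists>k. interior (F k) \<noteq> {}"
    then have "euclidean interior_of \<Union>(range F) = {}"
      by (intro Baire_category_alt) (auto simp: completely_metrizable_space_euclidean clF)
    then show False using cover by simp
  qed
  then obtain k x r where xr: "r > 0" "ball x r \<subseteq> F k"
    by (metis ex_in_conv mem_interior)
  have "norm v \<le> 4 * real k / r" if v: "v \<in> B" for v
  proof (cases "v = 0")
    case True
    then show ?thesis using xr by simp
  next
    case False
    \<comment> \<open>Two points of a ball inside \<open>F k\<close> that differ by a vector of
      length r / 2 in the direction of v; comparing their bounds isolates the norm of v.\<close>
    have "x \<in> F k" "x + (r / 2 / norm v) *\<^sub>R v \<in> F k"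
      using xr False by (auto intro!: subsetD[OF xr(2)] simp: dist_norm)
    then have "\<bar>rip x v\<bar> \<le> k" "\<bar>rip x v + (r / 2 / norm v) * (norm v)\<^sup>2\<bar> \<le> k"
      using v unfolding F_def by (auto simp: rip_simps rip_self)
    then have "(r / 2 / norm v) * (norm v)\<^sup>2 \<le> 2 * real k"
      by linarith
    then show ?thesis
      using False xr by (simp add: field_simps power2_eq_square)
  qed
  then show ?thesis by (rule that)
qed

section \<open>Operators bounded below and spectral gaps\<close>

definition bounded_below_on :: "'a::complex_hilbert set \<Rightarrow> ('a \<Rightarrow> 'a) \<Rightarrow> bool" where
  "bounded_below_on V T \<longleftrightarrow> (\<exists>c>0. \<forall>x\<in>V. c * norm x \<le> norm (T x))"

abbreviation bounded_below :: "('a::complex_hilbert \<Rightarrow> 'a) \<Rightarrow> bool" where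
  "bounded_below \<equiv> bounded_below_on UNIV"

lemma bounded_below_onI: "c > 0 \<Longrightarrow> (\<And>x. x \<in> V \<Longrightarrow> c * norm x \<le> norm (T x)) \<Longrightarrow> bounded_below_on V T"
  unfolding bounded_below_on_def by blast

lemma bounded_below_onE:
  assumes "bounded_below_on V T"
  obtains c where "c > 0" "\<And>x. x \<in> V \<Longrightarrow> c * norm x \<le> norm (T x)"
  using assms unfolding bounded_below_on_def by blast

lemma bounded_below_on_mono: "bounded_below_on V T \<Longrightarrow> U \<subseteq> V \<Longrightarrow> bounded_below_on U T"
  unfolding bounded_below_on_def by blast

lemma bounded_below_on_compose_right:
  assumes "bounded_op S" "bounded_below_on V (\<lambda>x. S (T x))"
  shows "bounded_below_on V T"
proof -
  obtain c where c: "c > 0" "\<And>x. x \<in> V \<Longrightarrow> c * norm x \<le> norm (S (T x))"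
    using bounded_below_onE[OF assms(2)] by blast
  obtain K where K: "K > 0" "\<And>x. norm (S x) \<le> K * norm x"
    using bounded_op_bound[OF assms(1)] by blast
  show ?thesis
  proof (rule bounded_below_onI)
    show "c / K > 0" using c K by simp
    fix x assume "x \<in> V"
    then have "c * norm x \<le> K * norm (T x)" using c(2) K(2) order_trans by blast
    then show "c / K * norm x \<le> norm (T x)" using K by (simp add: field_simps)
  qed
qed

lemma bounded_below_unit_iff:
  assumes "bounded_op T"
  shows "bounded_below T \<longleftrightarrow> (\<exists>e>0. \<forall>x. norm x = 1 \<longrightarrow> e \<le> norm (T x))"
proof
  show "\<exists>e>0. \<forall>x. norm x = 1 \<longrightarrow> e \<le> norm (T x)" if "bounded_below T"
    using that unfolding bounded_below_on_def by (metis UNIV_I mult.right_neutral)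
next
  assume "\<exists>e>0. \<forall>x. norm x = 1 \<longrightarrow> e \<le> norm (T x)"
  then obtain e where e: "e > 0" "\<And>x. norm x = 1 \<Longrightarrow> e \<le> norm (T x)" by blast
  show "bounded_below T"
  proof (rule bounded_below_onI[OF e(1)])
    fix x
    show "e * norm x \<le> norm (T x)"
    proof (cases "x = 0")
      case False
      then have "e \<le> norm (T ((1 / norm x) *\<^sub>R x))"
        by (intro e(2)) simp
      then show ?thesis
        using False by (simp add: bounded_op_linear_simps[OF assms] field_simps)
    qed simp
  qed
qed

lemma not_bounded_below_unit:
  assumes "bounded_op T" "\<not> bounded_below T" "e > 0"
  obtains x where "norm x = 1" "norm (T x) < e"
  using assms bounded_below_unit_iff[OF assms(1)] by (metis not_le)

lemma approx_point_spectrum_iff: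
  assumes "bounded_op S"
  shows "l \<in> approx_point_spectrum S \<longleftrightarrow> \<not> bounded_below (shift_op S l)"
proof
  assume "l \<in> approx_point_spectrum S"
  then obtain x where x: "\<And>k. norm (x k) = 1" "(\<lambda>k. shift_op S l (x k)) \<longlonglongrightarrow> 0"
    unfolding approx_point_spectrum_def by blast
  show "\<not> bounded_below (shift_op S l)"
  proof
    assume "bounded_below (shift_op S l)"
    then obtain e where "e > 0" "\<And>k. e \<le> norm (shift_op S l (x k))"
      using x(1) unfolding bounded_below_on_def by (metis UNIV_I mult.right_neutral)
    moreover obtain k where "norm (shift_op S l (x k)) < e"
      using order_tendstoD(2)[OF tendsto_norm_zero[OF x(2)] \<open>e > 0\<close>] unfolding eventually_sequentially
      by blast
    ultimately show False
      by (metis not_le)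
  qed
next
  assume "\<not> bounded_below (shift_op S l)"
  then have "\<exists>x. norm x = 1 \<and> norm (shift_op S l x) < 1 / Suc k" for k
    using not_bounded_below_unit[OF bounded_op_shift[OF assms], of l "1 / Suc k"] by auto
  then obtain x where x: "\<And>k. norm (x k) = 1" "\<And>k. norm (shift_op S l (x k)) < 1 / Suc k"
    by metis
  have "(\<lambda>k. shift_op S l (x k)) \<longlonglongrightarrow> 0"
    by (rule Lim_null_comparison[OF _ LIMSEQ_Suc[OF lim_1_over_n]])
      (use x(2) in \<open>auto intro!: always_eventually less_imp_le\<close>)
  then show "l \<in> approx_point_spectrum S"
    unfolding approx_point_spectrum_def using x(1) by blast
qed

text \<open>Cauchy-Schwarz for the semidefinite form \<open>rip (Q x) y\<close> at y = Q x.
  Consequently unit vectors on which the form of Q is small are approximate eigenvectors of Q for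
  0.\<close>

lemma positive_op_norm_bound:
  assumes Q: "adjoint_pair Q Q" and pos: "\<And>x. 0 \<le> rip (Q x) x"
  obtains L where "L > 0" "\<And>x. (norm (Q x))\<^sup>2 \<le> L * rip (Q x) x"
proof -
  have bop: "bounded_op Q" using adjoint_pairD(1)[OF Q] .
  obtain L where L: "L > 0" "\<And>x. norm (Q x) \<le> L * norm x"
    using bounded_op_bound[OF bop] by blast
  have "(norm (Q x))\<^sup>2 \<le> L * rip (Q x) x" for x
  proof -
    have "bilinear (\<lambda>x y. rip (Q x) y)"
      by (simp add: bilinear_def linear_iff bounded_op_linear_simps[OF bop] rip_simps)
    then have "(rip (Q x) (Q x))\<^sup>2 \<le> rip (Q x) x * rip (Q (Q x)) (Q x)"
      by (rule semidefinite_cauchy_schwarz) (use adjoint_pairD[OF Q] rip_commute pos in metis)+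
    also have "\<dots> \<le> rip (Q x) x * (norm (Q (Q x)) * norm (Q x))"
      using rip_cauchy_schwarz[of "Q (Q x)" "Q x"] by (intro mult_left_mono pos) linarith
    also have "\<dots> \<le> rip (Q x) x * (L * norm (Q x) * norm (Q x))"
      by (intro mult_left_mono mult_right_mono L pos) auto
    finally have *: "(norm (Q x))\<^sup>2 * (norm (Q x))\<^sup>2 \<le> (norm (Q x))\<^sup>2 * (L * rip (Q x) x)"
      by (simp add: rip_self power2_eq_square algebra_simps)
    show ?thesis
    proof (cases "Q x = 0")
      case False
      then show ?thesis using mult_left_le_imp_le[OF *] by simp
    qed (use L(1) pos[of x] in simp)
  qed
  with L(1) show ?thesis by (rule that)
qed

text \<open>With s the supremum of the numerical range, s - G is positive, so near-maximisers of the
  form of G are approximate eigenvectors for s. This takes the place of spectral theory for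
  self-adjoint operators.\<close>

lemma selfadjoint_sup_approximate_eigenvalue:
  fixes G :: "'a::complex_hilbert \<Rightarrow> 'a"
  assumes G: "adjoint_pair G G" and ne: "\<exists>x::'a. x \<noteq> 0"
  obtains s where "\<And>x. rip (G x) x \<le> s * (norm x)\<^sup>2"
    "\<And>e. e > 0 \<Longrightarrow> \<exists>x. norm x = 1 \<and> norm (s *\<^sub>R x - G x) < e"
proof -
  have bop: "bounded_op G" using adjoint_pairD(1)[OF G] .
  obtain K where K: "K > 0" "\<And>x. norm (G x) \<le> K * norm x"
    using bounded_op_bound[OF bop] by blast
  define R where "R = {rip (G x) x | x. norm x = 1}"
  define s where "s = Sup R"
  have Rne: "R \<noteq> {}"
  proof -
    obtain x :: 'a where "x \<noteq> 0" using ne by blast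
    then have "norm ((1 / norm x) *\<^sub>R x) = 1" by simp
    then show ?thesis unfolding R_def by blast
  qed
  have "r \<le> K" if "r \<in> R" for r
  proof -
    obtain x where "r = rip (G x) x" "norm x = 1"
      using \<open>r \<in> R\<close> unfolding R_def by blast
    then show ?thesis
      using rip_cauchy_schwarz[of "G x" x] K(2)[of x] by simp
  qed
  then have bdd: "bdd_above R" by (rule bdd_aboveI)
  have upper: "rip (G x) x \<le> s * (norm x)\<^sup>2" for x
  proof (cases "x = 0")
    case True
    then show ?thesis by (simp add: rip_simps)
  next
    case False
    define y where "y = (1 / norm x) *\<^sub>R x"
    have "norm y = 1" using False by (simp add: y_def)
    then have "rip (G y) y \<le> s"
      unfolding s_def by (intro cSup_upper bdd) (auto simp: R_def)
    then show ?thesis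
      using False by (simp add: y_def bounded_op_linear_simps[OF bop] rip_simps field_simps power2_eq_square)
  qed
  have "adjoint_pair (\<lambda>x. s *\<^sub>R x - G x) (\<lambda>x. s *\<^sub>R x - G x)"
    by (rule adjoint_pair_diff[OF adjoint_pair_scaleR[OF adjoint_pair_id] G])
  then obtain L where L: "L > 0" "\<And>x. (norm (s *\<^sub>R x - G x))\<^sup>2 \<le> L * rip (s *\<^sub>R x - G x) x"
    by (rule positive_op_norm_bound) (use upper in \<open>auto simp: rip_simps rip_self\<close>)
  have "\<exists>x. norm x = 1 \<and> norm (s *\<^sub>R x - G x) < e" if "e > 0" for e
  proof -
    \<comment> \<open>A loss below e^2 / L in the form costs less than e in the norm, by the bound
      with L.\<close>
    have "\<exists>r\<in>R. s - e\<^sup>2 / L < r"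
      using L(1) that less_cSup_iff[OF Rne bdd, of "s - e\<^sup>2 / L"] unfolding s_def by simp
    then obtain x where x: "norm x = 1" "s - e\<^sup>2 / L < rip (G x) x"
      unfolding R_def by blast
    have "(norm (s *\<^sub>R x - G x))\<^sup>2 \<le> L * (s - rip (G x) x)"
      using L(2)[of x] x(1) by (simp add: rip_simps rip_self)
    also have "\<dots> < e\<^sup>2"
      using x(2) L(1) by (simp add: field_simps)
    finally show ?thesis
      using x(1) that by (meson less_imp_le power_less_imp_less_base)
  qed
  with upper show ?thesis by (rule that)
qed

lemma subspace_closure:
  fixes S :: "'v::real_normed_vector set"
  assumes "subspace S"
  shows "subspace (closure S)"
proof (rule subspaceI)
  show "0 \<in> closure S" using subspace_0[OF assms] closure_subset by blast
  show "x + y \<in> closure S" if x: "x \<in> closure S" and y: "y \<in> closure S" for x y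
  proof -
    obtain f g where f: "\<And>k. f k \<in> S" "f \<longlonglongrightarrow> x" and g: "\<And>k. g k \<in> S" "g \<longlonglongrightarrow> y"
      using x y unfolding closure_sequential by blast
    have "f k + g k \<in> S" for k using subspace_add[OF assms f(1) g(1)] .
    moreover have "(\<lambda>k. f k + g k) \<longlonglongrightarrow> x + y" using f(2) g(2) by (rule tendsto_add)
    ultimately show ?thesis unfolding closure_sequential by (intro exI[of _ "\<lambda>k. f k + g k"]) simp
  qed
  show "c *\<^sub>R x \<in> closure S" if x: "x \<in> closure S" for c x
  proof -
    obtain f where f: "\<And>k. f k \<in> S" "f \<longlonglongrightarrow> x"
      using x unfolding closure_sequential by blast
    have "c *\<^sub>R f k \<in> S" for k using subspace_mul[OF assms f(1)] .
    moreover have "(\<lambda>k. c *\<^sub>R f k) \<longlonglongrightarrow> c *\<^sub>R x" by (intro tendsto_intros f(2))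
    ultimately show ?thesis unfolding closure_sequential by (intro exI[of _ "\<lambda>k. c *\<^sub>R f k"]) simp
  qed
qed

definition ortho_compl :: "'a::complex_hilbert set \<Rightarrow> 'a set" where
  "ortho_compl M = {x. \<forall>y\<in>M. rip y x = 0}"

text \<open>Let D = T' T and a = d / 2. Without approximate eigenvalues of D in (0, d), the operator
  D - a expands by at least a, whence d |T x|^2 \<le> |D x|^2. So T is bounded below by the root of
  d on the closed range of D, and what is orthogonal to that range lies in the kernel of T.\<close>

lemma spectral_gap_imp_bounded_below:
  fixes T :: "'a::complex_hilbert \<Rightarrow> 'a"
  assumes T: "adjoint_pair T T'" and d: "d > 0"
    and gap: "\<And>c. 0 < c \<Longrightarrow> c < d \<Longrightarrow> bounded_below (\<lambda>x. T' (T x) - c *\<^sub>R x)"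
  shows "bounded_below_on (ortho_compl {x. T x = 0}) T"
proof -
  note [simp] = bounded_op_linear_simps[OF adjoint_pairD(1)[OF T]]
    bounded_op_linear_simps[OF adjoint_pairD(2)[OF T]]
  define D where "D = (\<lambda>x. T' (T x))"
  define a where "a = d / 2"
  have D: "adjoint_pair D D"
    unfolding D_def by (rule adjoint_pair_compose[OF adjoint_pair_sym[OF T] T])
  have Da: "adjoint_pair (\<lambda>x. D x - a *\<^sub>R x) (\<lambda>x. D x - a *\<^sub>R x)"
    by (rule adjoint_pair_diff[OF D adjoint_pair_scaleR[OF adjoint_pair_id]])
  note [simp] = bounded_op_linear_simps[OF adjoint_pairD(1)[OF D]]
  have far: "(a * norm x)\<^sup>2 \<le> (norm (D x - a *\<^sub>R x))\<^sup>2" for x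
  proof (cases "\<exists>x::'a. x \<noteq> 0")
    case False
    then have "x = 0" by blast
    then show ?thesis by simp
  next
    case True
    \<comment> \<open>G = -(D - a)^2 has top s = -r^2 of its numerical range, and s - G factors as
      (D - (a - r)) (D - (a + r)). If r < a, both points lie in (0, d), so the product is bounded
      below, although s is an approximate eigenvalue of G.\<close>
    define G where "G x = (-1) *\<^sub>R (D (D x - a *\<^sub>R x) - a *\<^sub>R (D x - a *\<^sub>R x))" for x
    have G: "adjoint_pair G G"
      unfolding G_def by (rule adjoint_pair_scaleR[OF adjoint_pair_compose[OF Da Da]])
    have Gx: "rip (G x) x = - (norm (D x - a *\<^sub>R x))\<^sup>2" for x
      unfolding G_def rip_scaleR_left adjoint_pairD(3)[OF Da, of "D x - a *\<^sub>R x" x]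
      by (simp add: rip_self)
    obtain s where s: "\<And>x. rip (G x) x \<le> s * (norm x)\<^sup>2"
      "\<And>e. e > 0 \<Longrightarrow> \<exists>x. norm x = 1 \<and> norm (s *\<^sub>R x - G x) < e"
      using selfadjoint_sup_approximate_eigenvalue[OF G True] by blast
    have "s \<le> 0 + e" if e: "e > 0" for e
    proof -
      obtain x where x: "norm x = 1" "norm (s *\<^sub>R x - G x) < e" using s(2) e by blast
      have "s = rip (s *\<^sub>R x - G x) x + rip (G x) x"
        using x(1) by (simp add: rip_simps rip_self)
      also have "\<dots> \<le> norm (s *\<^sub>R x - G x) * norm x"
        unfolding Gx using rip_cauchy_schwarz[of "s *\<^sub>R x - G x" x]
        by (smt (verit) zero_le_power2)
      finally show ?thesis using x by simp
    qed
    then have "s \<le> 0" by (rule field_le_epsilon)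
    define r where "r = sqrt (- s)"
    have r: "r \<ge> 0" "r\<^sup>2 = - s" using \<open>s \<le> 0\<close> by (auto simp: r_def)
    have "a \<le> r"
    proof (rule ccontr)
      assume "\<not> a \<le> r"
      then have b: "bounded_below (\<lambda>x. D x - (a - r) *\<^sub>R x)" "bounded_below (\<lambda>x. D x - (a + r) *\<^sub>R x)"
        using gap[of "a - r"] gap[of "a + r"] r d unfolding D_def a_def by auto
      obtain c1 where c1: "c1 > 0" "\<And>x. c1 * norm x \<le> norm (D x - (a - r) *\<^sub>R x)"
        using bounded_below_onE[OF b(1)] by auto
      obtain c2 where c2: "c2 > 0" "\<And>x. c2 * norm x \<le> norm (D x - (a + r) *\<^sub>R x)"
        using bounded_below_onE[OF b(2)] by auto
      obtain x where x: "norm x = 1" "norm (s *\<^sub>R x - G x) < c1 * c2" using s(2) c1 c2 by (meson mult_pos_pos)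
      define y where "y = D x - (a + r) *\<^sub>R x"
      have "s *\<^sub>R x - G x = D y - (a - r) *\<^sub>R y"
      proof -
        have "s = - (r * r)" using r(2) by (simp add: power2_eq_square)
        then show ?thesis unfolding G_def y_def
          by (simp add: algebra_simps)
      qed
      then have "c1 * norm y \<le> norm (s *\<^sub>R x - G x)" using c1(2) by simp
      moreover have "c2 \<le> norm y" using c2(2)[of x] x(1) unfolding y_def by simp
      then have "c1 * c2 \<le> c1 * norm y" using c1(1) by (intro mult_left_mono) auto
      ultimately show False using x(2) by linarith
    qed
    then have "(a * norm x)\<^sup>2 \<le> (r * norm x)\<^sup>2"
      using d by (intro power_mono mult_right_mono) (auto simp: a_def)
    also have "\<dots> \<le> (norm (D x - a *\<^sub>R x))\<^sup>2"
      using s(1)[of x] Gx[of x] r(2) by (simp add: power_mult_distrib)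
    finally show ?thesis .
  qed
  \<comment> \<open>Expanding the square in \<open>far\<close>, the terms a^2 |x|^2 cancel and 2 a =
    d remains.\<close>
  have low: "d * (norm (T x))\<^sup>2 \<le> (norm (D x))\<^sup>2" for x
  proof -
    have "rip (D x) x = (norm (T x))\<^sup>2"
      unfolding D_def using adjoint_pairD(4)[OF T, of "T x" x] by (simp add: rip_self)
    then show ?thesis
      using far[of x] d unfolding norm_diff_squared
      by (simp add: a_def rip_simps power_mult_distrib)
  qed
  have onrange: "sqrt d * norm (D x) \<le> norm (T (D x))" for x
  proof -
    \<comment> \<open>Moving one T' across the product brings in T (D x); \<open>low\<close> then
      replaces the factor |T x| by |D x| divided by the root of d.\<close>
    have "(norm (D x))\<^sup>2 = rip (T (D x)) (T x)"
      using adjoint_pairD(4)[OF T, of "T x" "D x"] unfolding rip_self[symmetric]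
      by (simp add: D_def rip_commute)
    also have "\<dots> \<le> norm (T (D x)) * norm (T x)"
      using rip_cauchy_schwarz[of "T (D x)" "T x"] by linarith
    finally have 1: "(norm (D x))\<^sup>2 \<le> norm (T (D x)) * norm (T x)" .
    have "(sqrt d * norm (T x))\<^sup>2 \<le> (norm (D x))\<^sup>2"
      using low[of x] d by (simp add: power_mult_distrib)
    then have "sqrt d * norm (T x) \<le> norm (D x)"
      by (rule power2_le_imp_le) simp
    then have "norm (T (D x)) * (sqrt d * norm (T x)) \<le> norm (T (D x)) * norm (D x)"
      by (rule mult_left_mono) simp
    moreover have "sqrt d * (norm (D x))\<^sup>2 \<le> sqrt d * (norm (T (D x)) * norm (T x))"
      using 1 d by (intro mult_left_mono) auto
    ultimately have "sqrt d * (norm (D x))\<^sup>2 \<le> norm (T (D x)) * norm (D x)"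
      by (simp add: algebra_simps)
    then show ?thesis
      by (cases "norm (D x) = 0") (auto simp: power2_eq_square)
  qed
  define W where "W = closure (range D)"
  have W: "closed W" "subspace W"
  proof -
    have "subspace (range D)"
      by (intro linear_subspace_image subspace_UNIV bounded_linear.linear
          bounded_op_bounded_linear adjoint_pairD(1)[OF D])
    then show "subspace W" unfolding W_def by (rule subspace_closure)
  qed (simp add: W_def)
  have onW: "sqrt d * norm u \<le> norm (T u)" if "u \<in> W" for u
  proof -
    have "closed {u. sqrt d * norm u \<le> norm (T u)}"
      by (intro closed_Collect_le continuous_intros linear_continuous_on bounded_op_bounded_linear
          adjoint_pairD(1)[OF T])
    then have "W \<subseteq> {u. sqrt d * norm u \<le> norm (T u)}"
      unfolding W_def by (intro closure_minimal) (auto intro: onrange)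
    then show ?thesis using that by blast
  qed
  show ?thesis
  proof (rule bounded_below_onI)
    show "sqrt d > 0" using d by simp
    fix x assume x: "x \<in> ortho_compl {x. T x = 0}"
    obtain u v where uv: "x = u + v" "u \<in> W" "\<And>y. y \<in> W \<Longrightarrow> rip y v = 0"
      by (rule orthogonal_decomposition[OF W, of x]) auto
    have "D v \<in> W" unfolding W_def by (auto intro!: subsetD[OF closure_subset])
    \<comment> \<open>This product is |T v|^2, so v lies in the kernel of T; being orthogonal to
      both u and x, it vanishes.\<close>
    have "rip (D v) v = 0" using uv(3) \<open>D v \<in> W\<close> .
    then have "T v = 0"
      unfolding D_def adjoint_pairD(4)[OF T] by (simp add: rip_self)
    then have "rip v (u + v) = 0" using x uv(1) unfolding ortho_compl_def by blast
    moreover have "rip v u = 0" using uv(2,3) rip_commute by metis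
    ultimately have "v = 0" by (simp add: rip_simps rip_self)
    then show "sqrt d * norm x \<le> norm (T x)" using onW uv by simp
  qed
qed

section \<open>Joint approximate eigenvectors\<close>

text \<open>Maximising the numerical range of \<open>X\<close> with the penalty \<open>- t (Z\<^sub>1\<^sup>2 + Z\<^sub>2\<^sup>2)\<close> and letting \<open>t\<close> tend
  to infinity keeps the maximisers approximately in the kernels of \<open>Z\<^sub>1\<close> and \<open>Z\<^sub>2\<close>.\<close>
lemma joint_approximate_eigenvalue_selfadjoint:
  fixes X Z1 Z2 :: "'a::complex_hilbert \<Rightarrow> 'a"
  assumes X: "adjoint_pair X X" and Z1: "adjoint_pair Z1 Z1" and Z2: "adjoint_pair Z2 Z2"
    and c1: "\<And>x. X (Z1 x) = Z1 (X x)" and c2: "\<And>x. X (Z2 x) = Z2 (X x)"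
    and small: "\<And>e. e > 0 \<Longrightarrow> \<exists>x. norm x = 1 \<and> (norm (Z1 x))\<^sup>2 + (norm (Z2 x))\<^sup>2 < e"
  obtains s :: real where
    "\<And>e. e > 0 \<Longrightarrow> \<exists>x. norm x = 1 \<and> (norm (Z1 x))\<^sup>2 + (norm (Z2 x))\<^sup>2 < e \<and> norm (X x - s *\<^sub>R x) < e"
proof -
  note bops = adjoint_pairD(1)[OF X] adjoint_pairD(1)[OF Z1] adjoint_pairD(1)[OF Z2]
  note lin = bops[THEN bounded_op_linear_simps(1)] bops[THEN bounded_op_linear_simps(2)]
    bops[THEN bounded_op_linear_simps(5)]
  define \<Phi> where "\<Phi> x = (norm (Z1 x))\<^sup>2 + (norm (Z2 x))\<^sup>2" for x
  define \<Delta> where "\<Delta> x = Z1 (Z1 x) + Z2 (Z2 x)" for x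
  have \<Phi>0: "\<Phi> x \<ge> 0" for x by (simp add: \<Phi>_def)
  have \<Delta>: "adjoint_pair \<Delta> \<Delta>"
    unfolding \<Delta>_def
    by (rule adjoint_pair_add[OF adjoint_pair_compose[OF Z1 Z1] adjoint_pair_compose[OF Z2 Z2]])
  have rip_\<Delta>: "rip x (\<Delta> y) = rip (Z1 x) (Z1 y) + rip (Z2 x) (Z2 y)" for x y
    unfolding \<Delta>_def by (simp add: rip_simps adjoint_pairD(3)[OF Z1] adjoint_pairD(3)[OF Z2])
  have \<Delta>\<Phi>: "rip (\<Delta> x) x = \<Phi> x" for x
    unfolding rip_commute[of "\<Delta> x"] rip_\<Delta> \<Phi>_def by (simp add: rip_self)
  obtain K where K: "K > 0" "\<And>x. norm (X x) \<le> K * norm x"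
    using bounded_op_bound[OF bops(1)] by blast
  have XK: "\<bar>rip (X x) x\<bar> \<le> K" if "norm x = 1" for x
    using rip_cauchy_schwarz[of "X x" x] K(2)[of x] that by simp
  obtain x0 :: 'a where "norm x0 = 1" using small[of 1] by auto
  then have ne: "\<exists>x::'a. x \<noteq> 0" by (metis norm_zero zero_neq_one)
  \<comment> \<open>\<open>s t\<close> is the top of the numerical range of the penalised operator X
    - t \<Delta>, and the form of \<Delta> is \<Phi>.\<close>
  have "\<exists>s. (\<forall>x. rip (X x - t *\<^sub>R \<Delta> x) x \<le> s * (norm x)\<^sup>2) \<and>
     (\<forall>e>0. \<exists>x. norm x = 1 \<and> norm (s *\<^sub>R x - (X x - t *\<^sub>R \<Delta> x)) < e)" for t
    by (rule selfadjoint_sup_approximate_eigenvalue[OF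
          adjoint_pair_diff[OF X adjoint_pair_scaleR[OF \<Delta>]] ne, of t]) blast
  then obtain s where s1: "\<And>t x. rip (X x - t *\<^sub>R \<Delta> x) x \<le> s t * (norm x)\<^sup>2"
    and s2: "\<And>t e. e > 0 \<Longrightarrow> \<exists>x. norm x = 1 \<and> norm (s t *\<^sub>R x - (X x - t *\<^sub>R \<Delta> x)) < e"
    by metis
  have up: "rip (X x) x - t * \<Phi> x \<le> s t" if "norm x = 1" for t x
    using s1[of x t] that by (simp add: rip_simps \<Delta>\<Phi>)
  have low: "s t \<le> e + (rip (X x) x - t * \<Phi> x)"
    if "norm x = 1" "norm (s t *\<^sub>R x - (X x - t *\<^sub>R \<Delta> x)) < e" for t x e
  proof -
    have "rip (s t *\<^sub>R x - (X x - t *\<^sub>R \<Delta> x)) x \<le> e"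
      using rip_cauchy_schwarz[of "s t *\<^sub>R x - (X x - t *\<^sub>R \<Delta> x)" x] that by simp
    then show ?thesis using that(1) by (simp add: rip_simps \<Delta>\<Phi> rip_self)
  qed
  have anti: "s t' \<le> s t" if "t \<le> t'" for t t'
  proof (rule field_le_epsilon)
    fix e :: real assume "e > 0"
    then obtain x where x: "norm x = 1" "norm (s t' *\<^sub>R x - (X x - t' *\<^sub>R \<Delta> x)) < e"
      using s2 by blast
    have "t * \<Phi> x \<le> t' * \<Phi> x" using that \<Phi>0 by (simp add: mult_right_mono)
    then show "s t' \<le> s t + e" using low[OF x] up[OF x(1), of t] by linarith
  qed
  have lower: "- K \<le> s t" if "t > 0" for t
  proof (rule field_le_epsilon)
    fix e :: real assume "e > 0"
    then obtain x where x: "norm x = 1" "\<Phi> x < e / t"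
      using small[of "e / t"] \<open>t > 0\<close> unfolding \<Phi>_def by auto
    then have "t * \<Phi> x < e" using \<open>t > 0\<close> by (simp add: field_simps)
    then show "- K \<le> s t + e" using up[OF x(1), of t] XK[OF x(1)] by linarith
  qed
  have upper: "s t \<le> K" if "t > 0" for t
  proof (rule field_le_epsilon)
    fix e :: real assume "e > 0"
    then obtain x where x: "norm x = 1" "norm (s t *\<^sub>R x - (X x - t *\<^sub>R \<Delta> x)) < e"
      using s2 by blast
    have "t * \<Phi> x \<ge> 0" using \<Phi>0 that by simp
    then show "s t \<le> K + e" using low[OF x] XK[OF x(1)] by linarith
  qed
  \<comment> \<open>Doubling t makes consecutive tops comparable: they decrease to a limit, so their
    differences tend to 0.\<close>
  define \<sigma> where "\<sigma> k = s (2 ^ k)" for k :: nat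
  have "decseq \<sigma>"
    unfolding decseq_def \<sigma>_def by (intro allI impI anti) (simp add: power_increasing)
  moreover have "\<sigma> k \<ge> - K" for k unfolding \<sigma>_def by (rule lower) simp
  ultimately obtain s0 where s0: "\<sigma> \<longlonglongrightarrow> s0"
    using decseq_convergent by blast
  define \<rho> where "\<rho> k = \<sigma> k - \<sigma> (Suc k) + (1/2) ^ k" for k :: nat
  have \<eta>: "(\<lambda>k. (1/2::real) ^ k) \<longlonglongrightarrow> 0" by (rule LIMSEQ_power_zero) simp
  have \<rho>: "\<rho> \<longlonglongrightarrow> 0"
    unfolding \<rho>_def using tendsto_add[OF tendsto_diff[OF s0 LIMSEQ_Suc[OF s0]] \<eta>] by simp
  have step: "\<exists>x. norm x = 1 \<and> \<Phi> x \<le> \<rho> k \<and>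
     (norm (\<sigma> (Suc k) *\<^sub>R x - X x))\<^sup>2 \<le> (2 * K) * (1/2) ^ k + (2 * K) * (2 * \<rho> k)" for k
  proof -
    define t :: real where "t = 2 ^ Suc k"
    have t: "t \<ge> 2" "t > 0" unfolding t_def by simp_all
    obtain x where x: "norm x = 1" "norm (s t *\<^sub>R x - (X x - t *\<^sub>R \<Delta> x)) < (1/2) ^ k"
      using s2[of "(1/2) ^ k"] by auto
    define G where "G y = s t *\<^sub>R y - X y" for y
    define e where "e = s t *\<^sub>R x - (X x - t *\<^sub>R \<Delta> x)"
    have half: "s (t / 2) = \<sigma> k" "s t = \<sigma> (Suc k)" by (simp_all add: t_def \<sigma>_def)
    \<comment> \<open>A near-maximiser for t is a trial vector for t / 2, where it gains t / 2 times
      \<Phi> x. Hence the whole penalty t \<Phi> x tends to 0, not merely \<Phi> x.\<close>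
    have "t / 2 * \<Phi> x \<le> \<rho> k"
      using low[OF x] up[OF x(1), of "t / 2"] unfolding half \<rho>_def by simp
    then have t\<Phi>: "t * \<Phi> x \<le> 2 * \<rho> k" by simp
    have "2 * \<Phi> x \<le> t * \<Phi> x" using t \<Phi>0 by (intro mult_right_mono) auto
    then have "\<Phi> x \<le> \<rho> k" using t\<Phi> by linarith
    moreover have "(norm (G x))\<^sup>2 \<le> (2 * K) * (1/2) ^ k + (2 * K) * (2 * \<rho> k)"
    proof -
      have GK: "norm (G y) \<le> 2 * K * norm y" for y
      proof -
        have "norm (G y) \<le> \<bar>s t\<bar> * norm y + norm (X y)"
          unfolding G_def by (metis norm_scaleR norm_triangle_ineq4)
        also have "\<dots> \<le> K * norm y + K * norm y"
          using lower[OF t(2)] upper[OF t(2)] K by (intro add_mono mult_right_mono) auto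
        finally show ?thesis by simp
      qed
      have GZ: "\<bar>rip (G y) y\<bar> \<le> 2 * K * (norm y)\<^sup>2" for y
        using order_trans[OF rip_cauchy_schwarz mult_right_mono[OF GK norm_ge_zero]]
        by (simp add: power2_eq_square mult.assoc)
      have comm: "Z1 (G x) = G (Z1 x)" "Z2 (G x) = G (Z2 x)"
        unfolding G_def by (simp_all add: lin c1 c2)
      \<comment> \<open>The term t \<Delta> x need not be small in norm, but only its product with G
        x matters. As Z1 and Z2 commute with G, that product is a sum of forms of G at Z1 x and Z2
        x, controlled by the penalty t \<Phi> x.\<close>
      have "G x = e - t *\<^sub>R \<Delta> x" unfolding G_def e_def by simp
      then have "(norm (G x))\<^sup>2 = rip (G x) e - t * rip (G x) (\<Delta> x)"
        unfolding rip_self[symmetric] by (metis rip_simps(4,10) real_scaleR_def)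
      also have "rip (G x) (\<Delta> x) = rip (G (Z1 x)) (Z1 x) + rip (G (Z2 x)) (Z2 x)"
        unfolding rip_\<Delta> comm ..
      also have "rip (G x) e - t * \<dots> \<le> 2 * K * (1/2) ^ k + t * (2 * K * \<Phi> x)"
      proof -
        have "rip (G x) e \<le> norm (G x) * norm e" using rip_cauchy_schwarz[of "G x" e] by linarith
        also have "\<dots> \<le> 2 * K * (1/2) ^ k"
          using GK[of x] x K unfolding e_def by (intro mult_mono) auto
        finally have "rip (G x) e \<le> 2 * K * (1/2) ^ k" .
        moreover have "- (rip (G (Z1 x)) (Z1 x) + rip (G (Z2 x)) (Z2 x)) \<le> 2 * K * \<Phi> x"
          using GZ[of "Z1 x"] GZ[of "Z2 x"] unfolding \<Phi>_def by (simp add: algebra_simps)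
        then have "t * (- (rip (G (Z1 x)) (Z1 x) + rip (G (Z2 x)) (Z2 x))) \<le> t * (2 * K * \<Phi> x)"
          using t by (intro mult_left_mono) auto
        ultimately show ?thesis by (simp add: algebra_simps)
      qed
      also have "t * (2 * K * \<Phi> x) = 2 * K * (t * \<Phi> x)" by simp
      also have "2 * K * (1/2) ^ k + 2 * K * (t * \<Phi> x) \<le> 2 * K * (1/2) ^ k + 2 * K * (2 * \<rho> k)"
        using t\<Phi> K by (intro add_left_mono mult_left_mono) auto
      finally show ?thesis .
    qed
    ultimately show ?thesis using x(1) unfolding G_def half by blast
  qed
  show ?thesis
  proof (rule that[of s0])
    fix e :: real assume e: "e > 0"
    have "(\<lambda>k. (2 * K) * (1/2) ^ k + (2 * K) * (2 * \<rho> k)) \<longlonglongrightarrow> (2 * K) * 0 + (2 * K) * (2 * 0)"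
      by (intro tendsto_intros \<eta> \<rho>)
    then have "\<forall>\<^sub>F k in sequentially. (2 * K) * (1/2) ^ k + (2 * K) * (2 * \<rho> k) < (e / 2)\<^sup>2"
      by (rule order_tendstoD(2)) (use e in simp)
    moreover have "\<forall>\<^sub>F k in sequentially. \<rho> k < e" using \<rho> e by (rule order_tendstoD(2))
    moreover have "\<forall>\<^sub>F k in sequentially. dist (\<sigma> (Suc k)) s0 < e / 2"
      using LIMSEQ_Suc[OF s0] e by (intro tendstoD) auto
    ultimately have "\<forall>\<^sub>F k in sequentially. (2 * K) * (1/2) ^ k + (2 * K) * (2 * \<rho> k) < (e / 2)\<^sup>2 \<and>
        \<rho> k < e \<and> dist (\<sigma> (Suc k)) s0 < e / 2"
      by eventually_elim simp
    then obtain k where k: "(2 * K) * (1/2) ^ k + (2 * K) * (2 * \<rho> k) < (e / 2)\<^sup>2"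
        "\<rho> k < e" "dist (\<sigma> (Suc k)) s0 < e / 2"
      unfolding eventually_sequentially by blast
    obtain x where x: "norm x = 1" "\<Phi> x \<le> \<rho> k"
      "(norm (\<sigma> (Suc k) *\<^sub>R x - X x))\<^sup>2 \<le> (2 * K) * (1/2) ^ k + (2 * K) * (2 * \<rho> k)"
      using step by blast
    have "(norm (\<sigma> (Suc k) *\<^sub>R x - X x))\<^sup>2 < (e / 2)\<^sup>2" using x(3) k(1) by linarith
    then have "norm (\<sigma> (Suc k) *\<^sub>R x - X x) < e / 2"
      by (rule power_less_imp_less_base) (use e in simp)
    moreover have "norm (X x - s0 *\<^sub>R x) \<le> norm (\<sigma> (Suc k) *\<^sub>R x - X x) + norm ((\<sigma> (Suc k) - s0) *\<^sub>R x)"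
      using norm_triangle_ineq4[of "(\<sigma> (Suc k) - s0) *\<^sub>R x" "\<sigma> (Suc k) *\<^sub>R x - X x"]
      by (simp add: algebra_simps)
    moreover have "norm ((\<sigma> (Suc k) - s0) *\<^sub>R x) < e / 2"
      using k(3) x(1) by (simp add: dist_real_def)
    ultimately have "norm (X x - s0 *\<^sub>R x) < e" by linarith
    then show "\<exists>x. norm x = 1 \<and> (norm (Z1 x))\<^sup>2 + (norm (Z2 x))\<^sup>2 < e \<and> norm (X x - s0 *\<^sub>R x) < e"
      using x k(2) unfolding \<Phi>_def by (intro exI[of _ x]) linarith
  qed
qed

text \<open>Write N = X + i Y with commuting self-adjoint X and Y. The self-adjoint lemma is applied
  twice: to X with penalty D - c, which gives a, and then to Y with penalties D - c and X - a, which
  gives b; w is a + i b.\<close>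

lemma joint_approximate_eigenvalue_normal:
  fixes N :: "'a::complex_hilbert \<Rightarrow> 'a"
  assumes N: "adjoint_pair N N'" and normal: "\<And>x. N (N' x) = N' (N x)"
    and D: "adjoint_pair D D" and DN: "\<And>x. D (N x) = N (D x)" and DN': "\<And>x. D (N' x) = N' (D x)"
    and nbb: "\<not> bounded_below (\<lambda>x. D x - c *\<^sub>R x)"
  obtains w where
    "\<And>e. e > 0 \<Longrightarrow> \<exists>x. norm x = 1 \<and> norm (D x - c *\<^sub>R x) < e \<and> norm (shift_op N w x) < e"
proof -
  define X where "X x = (1/2) *\<^sub>R (N x + N' x)" for x
  define Y where "Y x = scaleC (- \<i> / 2) (N x - N' x)" for x
  define Z where "Z x = D x - c *\<^sub>R x" for x
  note N' = adjoint_pair_sym[OF N]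
  have X: "adjoint_pair X X"
    using adjoint_pair_scaleR[OF adjoint_pair_add[OF N N'], of "1/2"]
    unfolding X_def by (simp add: add.commute)
  have Y: "adjoint_pair Y Y"
  proof -
    have "(\<lambda>x. scaleC (cnj (- \<i> / 2)) (N' x - N x)) = Y"
      unfolding Y_def by (rule ext) (simp add: scaleC.scale_right_diff_distrib)
    then show ?thesis
      using adjoint_pair_scaleC[OF adjoint_pair_diff[OF N N'], of "- \<i> / 2"] unfolding Y_def by simp
  qed
  have Z: "adjoint_pair Z Z"
    unfolding Z_def by (rule adjoint_pair_diff[OF D adjoint_pair_scaleR[OF adjoint_pair_id]])
  note lin = bounded_op_linear_simps[OF adjoint_pairD(1)[OF N]] bounded_op_linear_simps[OF adjoint_pairD(2)[OF N]]
    bounded_op_linear_simps[OF adjoint_pairD(1)[OF D]]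
  have XZ: "X (Z x) = Z (X x)" for x
    unfolding X_def Z_def by (simp add: lin DN DN' algebra_simps)
  have YZ: "Y (Z x) = Z (Y x)" for x
    unfolding Y_def Z_def
    by (simp add: lin DN DN' algebra_simps scaleR_scaleC scaleC_scaleC scaleC.scale_right_diff_distrib
        scaleC_add_right)
  have XY: "Y (X x) = X (Y x)" for x
    unfolding Y_def X_def by (simp add: lin normal scaleR_scaleC scaleC_scaleC algebra_simps
       scaleC.scale_right_diff_distrib scaleC_add_right)
  have split: "shift_op N (Complex a b) x = (X x - a *\<^sub>R x) + scaleC \<i> (Y x - b *\<^sub>R x)" for a b x
  proof -
    have "N x = X x + scaleC \<i> (Y x)"
    proof -
      have "X x + scaleC \<i> (Y x) = (1/2) *\<^sub>R (N x + N' x) + (1/2) *\<^sub>R (N x - N' x)"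
        unfolding X_def Y_def by (simp add: scaleC_scaleC scaleR_scaleC)
      then show ?thesis by (simp add: scaleR_add_right[symmetric] del: scaleR_add_right)
    qed
    moreover have "scaleC (Complex a b) x = a *\<^sub>R x + scaleC \<i> (b *\<^sub>R x)"
      by (simp add: scaleR_scaleC scaleC_scaleC Complex_eq scaleC_add_left)
    ultimately show ?thesis
      unfolding shift_op_def by (simp add: scaleC.scale_right_diff_distrib)
  qed
  have zero: "adjoint_pair (\<lambda>x::'a. 0) (\<lambda>x. 0)"
    by (simp add: adjoint_pair_def rip_simps)
  obtain a where a: "\<And>e. e > 0 \<Longrightarrow> \<exists>x. norm x = 1 \<and> (norm (Z x))\<^sup>2 + (norm (0::'a))\<^sup>2 < e \<and> norm (X x - a *\<^sub>R x) < e"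
  proof (rule joint_approximate_eigenvalue_selfadjoint[OF X Z zero XZ])
    show "X 0 = 0" for x :: 'a unfolding X_def by (simp add: lin)
    fix e :: real assume "e > 0"
    then obtain x where "norm x = 1" "norm (Z x) < sqrt e"
      using not_bounded_below_unit[OF adjoint_pairD(1)[OF Z], of "sqrt e"] nbb unfolding Z_def by auto
    then show "\<exists>x. norm x = 1 \<and> (norm (Z x))\<^sup>2 + (norm (0::'a))\<^sup>2 < e"
      using \<open>e > 0\<close> by (metis add.right_neutral norm_ge_zero norm_zero power_strict_mono pos2
         real_sqrt_pow2 less_imp_le zero_power2)
  qed auto
  define Z2 where "Z2 x = X x - a *\<^sub>R x" for x
  have Z2: "adjoint_pair Z2 Z2"
    unfolding Z2_def by (rule adjoint_pair_diff[OF X adjoint_pair_scaleR[OF adjoint_pair_id]])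
  have YZ2: "Y (Z2 x) = Z2 (Y x)" for x
    unfolding Z2_def using XY
    by (simp add: bounded_op_linear_simps[OF adjoint_pairD(1)[OF Y]])
  obtain b where b: "\<And>e. e > 0 \<Longrightarrow> \<exists>x. norm x = 1 \<and> (norm (Z x))\<^sup>2 + (norm (Z2 x))\<^sup>2 < e \<and> norm (Y x - b *\<^sub>R x) < e"
  proof (rule joint_approximate_eigenvalue_selfadjoint[OF Y Z Z2 YZ YZ2])
    fix e :: real assume e: "e > 0"
    obtain x where x: "norm x = 1" "(norm (Z x))\<^sup>2 < min 1 (e/2)" "norm (Z2 x) < min 1 (e/2)"
      using a[of "min 1 (e/2)"] e unfolding Z2_def by auto
    \<comment> \<open>The first application bounds the norm itself, whereas the second wants its
      square; smallness below 1 bridges the two.\<close>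
    have "(norm (Z2 x))\<^sup>2 \<le> norm (Z2 x)"
      using x(3) by (simp add: power2_eq_square mult_left_le)
    then show "\<exists>x. norm x = 1 \<and> (norm (Z x))\<^sup>2 + (norm (Z2 x))\<^sup>2 < e"
      using x by (intro exI[of _ x]) auto
  qed auto
  show ?thesis
  proof (rule that[of "Complex a b"])
    fix e :: real assume e: "e > 0"
    \<comment> \<open>The squares of the first two norms and the third norm itself have to drop
      below their targets at once.\<close>
    define r where "r = min (e/2) ((e/2)\<^sup>2)"
    have "r > 0" using e by (simp add: r_def)
    then obtain x where x: "norm x = 1" "(norm (Z x))\<^sup>2 + (norm (Z2 x))\<^sup>2 < r" "norm (Y x - b *\<^sub>R x) < r"
      using b by blast
    have "(norm (Z x))\<^sup>2 < (e/2)\<^sup>2" "(norm (Z2 x))\<^sup>2 < (e/2)\<^sup>2"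
      using x(2) unfolding r_def by (smt (verit) zero_le_power2)+
    then have "norm (Z x) < e/2" "norm (Z2 x) < e/2"
      using e power_less_imp_less_base[of _ 2 "e/2"] by auto
    moreover have "norm (shift_op N (Complex a b) x) \<le> norm (Z2 x) + norm (Y x - b *\<^sub>R x)"
      unfolding split Z2_def
      using norm_triangle_ineq[of "X x - a *\<^sub>R x" "scaleC \<i> (Y x - b *\<^sub>R x)"] by (simp add: norm_scaleC)
    moreover have "norm (Y x - b *\<^sub>R x) < e/2" using x(3) by (simp add: r_def)
    ultimately show "\<exists>x. norm x = 1 \<and> norm (D x - c *\<^sub>R x) < e \<and> norm (shift_op N (Complex a b) x) < e"
      using x(1) e unfolding Z_def by (intro exI[of _ x]) auto
  qed
qed

section \<open>Invertibility on closed subspaces and power quotients\<close>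

lemma ortho_compl_closed_subspace: "closed (ortho_compl M)" "subspace (ortho_compl M)"
proof -
  have "closed {x. rip y x = 0}" for y :: 'a
    by (intro closed_Collect_eq continuous_intros linear_continuous_on
        bounded_bilinear.bounded_linear_right[OF bounded_bilinear_rip])
  moreover have "ortho_compl M = (\<Inter>y\<in>M. {x. rip y x = 0})"
    by (auto simp: ortho_compl_def)
  ultimately show "closed (ortho_compl M)" by auto
  show "subspace (ortho_compl M)"
    by (simp add: subspace_def ortho_compl_def rip_simps)
qed

lemma ortho_compl_invariant:
  assumes "adjoint_pair S S'" "\<And>x. x \<in> M \<Longrightarrow> S' x \<in> M" "x \<in> ortho_compl M"
  shows "S x \<in> ortho_compl M"
  using assms(2,3) unfolding ortho_compl_def by (simp add: adjoint_pairD(4)[OF assms(1), symmetric])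

lemma ortho_compl_disjoint: "x \<in> M \<Longrightarrow> x \<in> ortho_compl M \<Longrightarrow> x = 0"
  unfolding ortho_compl_def using rip_self[of x] by simp

lemma ortho_compl_antimono: "M \<subseteq> L \<Longrightarrow> ortho_compl L \<subseteq> ortho_compl M"
  unfolding ortho_compl_def by blast

lemma ortho_compl_decomposition:
  assumes "closed M" "subspace M"
  obtains u v where "x = u + v" "u \<in> M" "v \<in> ortho_compl M"
  by (rule orthogonal_decomposition[OF assms, of x]) (auto simp: ortho_compl_def)

text \<open>On an orthogonal sum of two invariant subspaces Pythagoras applies to x and to T x, so
  the smaller constant serves.\<close>

lemma bounded_below_combine:
  assumes M: "closed M" "subspace M" and T: "bounded_op T"
    and inv: "\<And>x. x \<in> M \<Longrightarrow> T x \<in> M" "\<And>x. x \<in> ortho_compl M \<Longrightarrow> T x \<in> ortho_compl M"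
    and bb: "bounded_below_on M T" "bounded_below_on (ortho_compl M) T"
  shows "bounded_below T"
proof -
  obtain a where a: "a > 0" "\<And>x. x \<in> M \<Longrightarrow> a * norm x \<le> norm (T x)"
    using bounded_below_onE[OF bb(1)] by blast
  obtain b where b: "b > 0" "\<And>x. x \<in> ortho_compl M \<Longrightarrow> b * norm x \<le> norm (T x)"
    using bounded_below_onE[OF bb(2)] by blast
  define c where "c = min a b"
  have c: "c > 0" using a b by (simp add: c_def)
  have pyth: "(norm (u + v))\<^sup>2 = (norm u)\<^sup>2 + (norm v)\<^sup>2" if "u \<in> M" "v \<in> ortho_compl M" for u v
    using that by (simp add: norm_add_squared ortho_compl_def)
  show ?thesis
  proof (rule bounded_below_onI[OF c])
    fix x
    obtain u v where uv: "x = u + v" "u \<in> M" "v \<in> ortho_compl M"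
      by (rule ortho_compl_decomposition[OF M])
    have "c * norm u \<le> norm (T u)" "c * norm v \<le> norm (T v)"
      using a(2)[OF uv(2)] b(2)[OF uv(3)] mult_right_mono[of c a "norm u"] mult_right_mono[of c b "norm v"]
      by (auto simp: c_def)
    then have "(c * norm u)\<^sup>2 + (c * norm v)\<^sup>2 \<le> (norm (T u))\<^sup>2 + (norm (T v))\<^sup>2"
      using c by (intro add_mono power_mono) auto
    also have "\<dots> = (norm (T x))\<^sup>2"
      unfolding uv(1) bounded_op_linear_simps(1)[OF T] by (rule pyth[symmetric]) (use inv uv in auto)
    finally have "(c * norm x)\<^sup>2 \<le> (norm (T x))\<^sup>2"
      unfolding uv(1) power_mult_distrib pyth[OF uv(2,3)] by (simp add: algebra_simps)
    then show "c * norm x \<le> norm (T x)" by (rule power2_le_imp_le) simp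
  qed
qed

lemma closed_image_bounded_below:
  assumes "bounded_op T" "closed V" "subspace V" "bounded_below_on V T"
  shows "closed (T ` V)"
proof -
  obtain c where c: "c > 0" "\<And>x. x \<in> V \<Longrightarrow> c * norm x \<le> norm (T x)"
    using bounded_below_onE[OF assms(4)] by blast
  have "complete V" using assms(2) by (simp add: complete_eq_closed)
  then have "complete (T ` V)"
    using c by (intro complete_isometric_image[OF c(1) assms(3) bounded_op_bounded_linear[OF assms(1)]]) auto
  then show ?thesis by (simp add: complete_eq_closed)
qed

text \<open>The image of V is closed. If v in V is orthogonal to it, then |T' v|^2 is the product of
  T (T' v) and v, hence zero, and injectivity of T' on V gives v = 0.\<close>

lemma bounded_below_imp_onto:
  assumes T: "adjoint_pair T T'" and V: "closed V" "subspace V"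
    and inv: "\<And>x. x \<in> V \<Longrightarrow> T x \<in> V" "\<And>x. x \<in> V \<Longrightarrow> T' x \<in> V"
    and bb: "bounded_below_on V T" and inj: "\<And>x. x \<in> V \<Longrightarrow> T' x = 0 \<Longrightarrow> x = 0"
  shows "T ` V = V"
proof
  show "T ` V \<subseteq> V" using inv(1) by blast
  have W: "closed (T ` V)" "subspace (T ` V)"
    using closed_image_bounded_below[OF adjoint_pairD(1)[OF T] V bb]
      linear_subspace_image[OF bounded_linear.linear[OF bounded_op_bounded_linear[OF adjoint_pairD(1)[OF T]]] V(2)]
    by auto
  show "V \<subseteq> T ` V"
  proof
    fix x assume x: "x \<in> V"
    obtain u v where uv: "x = u + v" "u \<in> T ` V" "\<And>y. y \<in> T ` V \<Longrightarrow> rip y v = 0"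
      by (rule orthogonal_decomposition[OF W, of x]) auto
    have "v \<in> V"
      using subspace_diff[OF V(2) x, of u] uv inv(1) by auto
    then have "rip (T (T' v)) v = 0" using uv(3) inv(2) by blast
    then have "T' v = 0" by (simp add: adjoint_pairD(3)[OF T] rip_self)
    then have "v = 0" using inj \<open>v \<in> V\<close> by blast
    then show "x \<in> T ` V" using uv(1,2) by simp
  qed
qed

text \<open>Bounded inverse theorem: surjectivity of \<open>T\<close> makes the preimage of the unit ball under
  \<open>T'\<close> weakly bounded.\<close>
lemma bijective_imp_bounded_below:
  fixes T :: "'a::complex_hilbert \<Rightarrow> 'a"
  assumes T: "adjoint_pair T T'" and V: "closed V" "subspace V"
    and inv: "\<And>x. x \<in> V \<Longrightarrow> T' x \<in> V"
    and onto: "T ` V = V" and inj: "\<And>x. x \<in> V \<Longrightarrow> T x = 0 \<Longrightarrow> x = 0"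
  shows "bounded_below_on V T"
proof -
  note lin' = bounded_op_linear_simps[OF adjoint_pairD(2)[OF T]]
  have weak: "\<exists>c. \<forall>v\<in>{v\<in>V. norm (T' v) \<le> 1}. \<bar>rip x v\<bar> \<le> c" for x
  proof -
    obtain x1 x2 where x: "x = x1 + x2" "x1 \<in> V" "\<And>v. v \<in> V \<Longrightarrow> rip v x2 = 0"
      by (rule orthogonal_decomposition[OF V, of x]) auto
    have "x1 \<in> T ` V" using x(2) onto by simp
    then obtain y where y: "x1 = T y" by (rule imageE)
    have "\<bar>rip x v\<bar> \<le> norm y" if "v \<in> V" "norm (T' v) \<le> 1" for v
    proof -
      \<comment> \<open>The component x2 is orthogonal to V and T y is the other one, so the
        preimage y gives a bound independent of v.\<close>
      have "rip x v = rip y (T' v)"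
        using x(3)[OF that(1)] unfolding x(1) y by (simp add: rip_simps adjoint_pairD(3)[OF T] rip_commute[of x2])
      then show ?thesis
        using rip_cauchy_schwarz[of y "T' v"] mult_left_le[OF that(2) norm_ge_zero[of y]] by simp
    qed
    then show ?thesis by blast
  qed
  obtain C where C: "\<And>v. v \<in> V \<Longrightarrow> norm (T' v) \<le> 1 \<Longrightarrow> norm v \<le> C"
    by (rule weakly_bounded_imp_bounded[OF weak]) auto
  have C0: "C \<ge> 0" using C[OF subspace_0[OF V(2)]] by (simp add: lin')
  have bb': "norm v \<le> C * norm (T' v)" if v: "v \<in> V" for v
  proof (cases "T' v = 0")
    case True
    have "v \<in> T ` V" using v onto by simp
    then obtain y where "v = T y" by (rule imageE)
    then have "rip v v = rip y (T' v)" using adjoint_pairD(3)[OF T] by metis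
    then show ?thesis using True by (simp add: rip_simps rip_self)
  next
    case False
    then have "norm ((1 / norm (T' v)) *\<^sub>R v) \<le> C"
      by (intro C subspace_mul V v) (simp add: lin')
    then show ?thesis using False by (simp add: field_simps)
  qed
  have "bounded_below_on V T'"
  proof (rule bounded_below_onI)
    \<comment> \<open>The bound C may be 0, hence the denominator C + 1.\<close>
    show "1 / (C + 1) > 0" using C0 by simp
    fix x assume "x \<in> V"
    then have "norm x \<le> (C + 1) * norm (T' x)" using bb'[of x] by (simp add: algebra_simps add_increasing)
    then show "1 / (C + 1) * norm x \<le> norm (T' x)" using C0 by (simp add: field_simps)
  qed
  then have onto': "T' ` V = V"
    using bounded_below_imp_onto[OF adjoint_pair_sym[OF T] V inv _ _ inj] onto by blast
  show ?thesis
  proof (rule bounded_below_onI)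
    show "1 / (C + 1) > 0" using C0 by simp
    fix x assume "x \<in> V"
    then have "x \<in> T' ` V" using onto' by simp
    then obtain v where v: "v \<in> V" "x = T' v" by blast
    \<comment> \<open>Surjectivity of T' on V carries the lower bound over from T' to T.\<close>
    have "(norm x)\<^sup>2 = rip v (T x)"
      unfolding rip_self[symmetric] using adjoint_pairD(4)[OF T, of v x] v(2) by simp
    also have "\<dots> \<le> norm v * norm (T x)" using rip_cauchy_schwarz[of v "T x"] by linarith
    also have "\<dots> \<le> (C * norm x) * norm (T x)"
      using bb'[OF v(1)] v(2) by (intro mult_right_mono) auto
    finally have "norm x * norm x \<le> norm x * (C * norm (T x))"
      by (simp add: power2_eq_square algebra_simps)
    then have "norm x \<le> C * norm (T x)"
      using C0 by (cases "norm x = 0") auto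
    then have "norm x \<le> (C + 1) * norm (T x)" by (simp add: algebra_simps add_increasing)
    then show "1 / (C + 1) * norm x \<le> norm (T x)" using C0 by (simp add: field_simps)
  qed
qed

section \<open>Cofactors of A - z in the polynomial A^n - z^n\<close>

text \<open>\<open>power_quot A z n\<close> is the quotient \<open>q(A) = (A\<^sup>n - z\<^sup>n) / (A - z)\<close>, and \<open>power_quot2 A z n\<close> is
  \<open>(q(A) - q(z)) / (A - z)\<close>.\<close>
definition power_quot :: "('a::complex_hilbert \<Rightarrow> 'a) \<Rightarrow> complex \<Rightarrow> nat \<Rightarrow> 'a \<Rightarrow> 'a" where
  "power_quot A z j x = (\<Sum>i<j. scaleC (z ^ (j - Suc i)) ((A ^^ i) x))"

definition power_quot2 :: "('a::complex_hilbert \<Rightarrow> 'a) \<Rightarrow> complex \<Rightarrow> nat \<Rightarrow> 'a \<Rightarrow> 'a" where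
  "power_quot2 A z j x = (\<Sum>i<j. scaleC (z ^ (j - Suc i)) (power_quot A z i x))"

lemma power_quot_Suc: "power_quot A z (Suc j) x = (A ^^ j) x + scaleC z (power_quot A z j x)"
proof -
  have "(\<Sum>i<j. scaleC (z ^ (j - i)) ((A ^^ i) x)) = scaleC z (power_quot A z j x)"
    unfolding power_quot_def scaleC.scale_sum_right
  proof (rule sum.cong[OF refl])
    fix i assume "i \<in> {..<j}"
    then have "j - i = Suc (j - Suc i)" by auto
    then show "scaleC (z ^ (j - i)) ((A ^^ i) x) = scaleC z (scaleC (z ^ (j - Suc i)) ((A ^^ i) x))"
      by (simp add: scaleC_scaleC)
  qed
  then show ?thesis unfolding power_quot_def by (simp add: scaleC_one)
qed

lemma bounded_op_power_quot: "bounded_op A \<Longrightarrow> bounded_op (power_quot A z j)"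
  unfolding power_quot_def by (intro bounded_op_sum bounded_op_scaleC_compose bounded_op_funpow)

lemma bounded_op_power_quot2: "bounded_op A \<Longrightarrow> bounded_op (power_quot2 A z j)"
  unfolding power_quot2_def by (intro bounded_op_sum bounded_op_scaleC_compose bounded_op_power_quot)

lemma power_quot_commute:
  assumes "bounded_op A"
  shows "power_quot A z j (A x) = A (power_quot A z j x)"
  unfolding power_quot_def
  by (simp add: linear_sum[OF bounded_linear.linear[OF bounded_op_bounded_linear[OF assms]]]
      bounded_op_scaleC[OF assms] funpow_swap1)

lemma power_quot2_commute:
  assumes "bounded_op A"
  shows "power_quot2 A z j (A x) = A (power_quot2 A z j x)"
  unfolding power_quot2_def
  by (simp add: linear_sum[OF bounded_linear.linear[OF bounded_op_bounded_linear[OF assms]]]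
      bounded_op_scaleC[OF assms] power_quot_commute[OF assms])

lemma power_quot_shift_commute:
  assumes "bounded_op A"
  shows "power_quot A z j (shift_op A l x) = shift_op A l (power_quot A z j x)"
    "power_quot2 A z j (shift_op A l x) = shift_op A l (power_quot2 A z j x)"
  unfolding shift_op_def
  by (simp_all add: power_quot_commute[OF assms] power_quot2_commute[OF assms]
      bounded_op_linear_simps[OF bounded_op_power_quot[OF assms]]
      bounded_op_linear_simps[OF bounded_op_power_quot2[OF assms]])

lemma shift_power_quot:
  assumes "bounded_op A"
  shows "shift_op A z (power_quot A z j x) = shift_op (A ^^ j) (z ^ j) x"
proof (induction j)
  case 0
  then show ?case
    by (simp add: power_quot_def shift_op_def bounded_op_linear_simps[OF assms] scaleC_one)
next
  case (Suc j)
  have "shift_op A z (power_quot A z (Suc j) x)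
      = shift_op A z ((A ^^ j) x) + scaleC z (shift_op A z (power_quot A z j x))"
    unfolding power_quot_Suc by (simp add: bounded_op_linear_simps[OF bounded_op_shift[OF assms]])
  then show ?case
    unfolding Suc.IH by (simp add: shift_op_def scaleC.scale_right_diff_distrib scaleC_scaleC)
qed

text \<open>At z the polynomial q takes the value n z^(n-1), and q - q(z) is divisible by the shift.
  So on approximate eigenvectors of A for z the cofactor acts almost as this scalar, which is
  nonzero when z is nonzero and n > 0.\<close>

lemma power_quot_remainder:
  assumes "bounded_op A"
  shows "power_quot A z n x - scaleC (of_nat n * z ^ (n - 1)) x = power_quot2 A z n (shift_op A z x)"
proof -
  have "power_quot2 A z n (shift_op A z x)
      = (\<Sum>i<n. scaleC (z ^ (n - Suc i)) ((A ^^ i) x - scaleC (z ^ i) x))"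
    unfolding power_quot2_def power_quot_shift_commute[OF assms] shift_power_quot[OF assms]
    by (simp add: shift_op_def)
  also have "\<dots> = power_quot A z n x - (\<Sum>i<n. scaleC (z ^ (n - Suc i) * z ^ i) x)"
    unfolding power_quot_def by (simp add: scaleC.scale_right_diff_distrib sum_subtractf scaleC_scaleC)
  also have "(\<Sum>i<n. scaleC (z ^ (n - Suc i) * z ^ i) x) = (\<Sum>i<n. scaleC (z ^ (n - 1)) x)"
    by (intro sum.cong refl) (simp flip: power_add)
  also have "\<dots> = scaleC (of_nat n * z ^ (n - 1)) x"
    by (simp add: scaleC.scale_sum_left[symmetric])
  finally show ?thesis by simp
qed

lemma power_quot_bound:
  assumes "bounded_op A"
  obtains C where "C > 0" "\<And>z x. cmod z \<le> r \<Longrightarrow> norm (power_quot A z j x) \<le> C * norm x"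
proof -
  have "\<exists>C\<ge>0. \<forall>z x. cmod z \<le> r \<longrightarrow> norm (power_quot A z j x) \<le> C * norm x"
  proof (induction j)
    case 0
    then show ?case by (intro exI[of _ 0]) (simp add: power_quot_def)
  next
    case (Suc j)
    then obtain C where C: "C \<ge> 0" "\<And>z x. cmod z \<le> r \<Longrightarrow> norm (power_quot A z j x) \<le> C * norm x" by blast
    obtain K where K: "K > 0" "\<And>x. norm ((A ^^ j) x) \<le> K * norm x"
      using bounded_op_bound[OF bounded_op_funpow[OF assms]] by blast
    have "norm (power_quot A z (Suc j) x) \<le> (K + \<bar>r\<bar> * C) * norm x" if "cmod z \<le> r" for z x
    proof -
      have "norm (power_quot A z (Suc j) x) \<le> norm ((A ^^ j) x) + cmod z * norm (power_quot A z j x)"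
        unfolding power_quot_Suc by (metis norm_scaleC norm_triangle_ineq)
      also have "\<dots> \<le> K * norm x + \<bar>r\<bar> * (C * norm x)"
        using that by (intro add_mono mult_mono K C) auto
      finally show ?thesis by (simp add: algebra_simps)
    qed
    then show ?case using K(1) C(1) by (intro exI[of _ "K + \<bar>r\<bar> * C"]) auto
  qed
  then obtain C where C: "C \<ge> 0" "\<And>z x. cmod z \<le> r \<Longrightarrow> norm (power_quot A z j x) \<le> C * norm x" by blast
  show ?thesis
  proof (rule that[of "C + 1"])
    show "norm (power_quot A z j x) \<le> (C + 1) * norm x" if "cmod z \<le> r" for z x
      using C(2)[OF that, of x] by (simp add: algebra_simps add_increasing)
  qed (use C(1) in simp)
qed

text \<open>The bound is uniform on a disc because the root z to which it is applied is found only
  after the constants have been fixed.\<close>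

lemma power_quot2_bound:
  assumes A: "bounded_op A"
  obtains C where "C > 0" "\<And>z x. cmod z \<le> r \<Longrightarrow> norm (power_quot2 A z n x) \<le> C * norm x"
proof -
  have "\<exists>C. \<forall>z x. cmod z \<le> r \<longrightarrow> norm (power_quot A z i x) \<le> C * norm x" for i
    by (rule power_quot_bound[OF A, of r i]) blast
  then obtain C where C: "\<And>i z x. cmod z \<le> r \<Longrightarrow> norm (power_quot A z i x) \<le> C i * norm x"
    by metis
  define K where "K = (\<Sum>i<n. \<bar>r\<bar> ^ (n - Suc i) * \<bar>C i\<bar>)"
  have K0: "K \<ge> 0" unfolding K_def by (intro sum_nonneg) simp
  have "norm (power_quot2 A z n x) \<le> (K + 1) * norm x" if z: "cmod z \<le> r" for z x
  proof -
    have "norm (power_quot2 A z n x) \<le> (\<Sum>i<n. (\<bar>r\<bar> ^ (n - Suc i) * \<bar>C i\<bar>) * norm x)"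
      unfolding power_quot2_def
    proof (rule sum_norm_le)
      fix i
      have "norm (power_quot A z i x) \<le> \<bar>C i\<bar> * norm x"
        using C[OF z, of i x] mult_right_mono[OF abs_ge_self norm_ge_zero, of "C i" x] by linarith
      moreover have "cmod z ^ (n - Suc i) \<le> \<bar>r\<bar> ^ (n - Suc i)" using z by (intro power_mono) auto
      ultimately show "norm (scaleC (z ^ (n - Suc i)) (power_quot A z i x)) \<le> (\<bar>r\<bar> ^ (n - Suc i) * \<bar>C i\<bar>) * norm x"
        unfolding norm_scaleC norm_power mult.assoc by (intro mult_mono) auto
    qed
    then show ?thesis
      unfolding sum_distrib_right[symmetric] K_def[symmetric] by (simp add: algebra_simps add_increasing)
  qed
  then show ?thesis using that[of "K + 1"] K0 by simp
qed

text \<open>The restriction of T to the closed range of T^m is bijective: its kernel has dimension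
  0, and the index inequality follows since 0 is the least \<open>enat\<close>.\<close>

lemma upper_semi_B_Weyl_if_bijective_on_range:
  fixes T :: "'a::complex_hilbert \<Rightarrow> 'a"
  assumes cl: "closed (range (T ^^ m))" and onto: "range (T ^^ m) \<subseteq> T ` range (T ^^ m)"
    and inj: "\<And>x. T ((T ^^ m) x) = 0 \<Longrightarrow> (T ^^ m) x = 0" and T: "bounded_op T"
  shows "upper_semi_B_Weyl T"
proof -
  define R where "R = range (T ^^ m)"
  have TR: "T ` R = R"
  proof
    show "T ` R \<subseteq> R" unfolding R_def using funpow_swap1[of T m] by (auto simp: funpow_swap1)
  qed (use onto in \<open>simp add: R_def\<close>)
  have "0 \<in> R" unfolding R_def
    by (metis bounded_op_linear_simps(4)[OF bounded_op_funpow[OF T]] rangeI)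
  then have K: "{x \<in> R. T x = 0} = {0}"
    using inj bounded_op_linear_simps(4)[OF T] unfolding R_def by auto
  have ex: "\<exists>F::'a set. finite F \<and> card F = 0 \<and> F \<subseteq> {0} \<and> {0} \<subseteq> cspan ({} \<union> F)"
    by (intro exI[of _ "{}"]) (auto simp: cspan_def)
  then have "(LEAST n. \<exists>F::'a set. finite F \<and> card F = n \<and> F \<subseteq> {0} \<and> {0} \<subseteq> cspan ({} \<union> F)) = 0"
    by (rule Least_eq_0)
  then have "cdim {0::'a} = 0"
    using ex unfolding cdim_def rel_cdim_def by (auto simp: zero_enat_def)
  then show ?thesis
    unfolding upper_semi_B_Weyl_def
    using cl unfolding R_def[symmetric]
    by (intro exI[of _ m]) (simp add: Let_def K TR del: not_infinity_eq flip: R_def)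
qed

section \<open>Operators with a normal power\<close>

lemma complex_nth_root_exists:
  fixes w :: complex
  assumes "n > 0"
  obtains z where "z ^ n = w"
proof (cases "w = 0")
  case True
  then show ?thesis using that[of 0] assms by simp
next
  case False
  have "exp (Ln w / of_nat n) ^ n = w"
    using assms False by (simp flip: exp_of_nat_mult)
  then show ?thesis by (rule that)
qed

lemma complex_nth_root_near:
  fixes l :: complex
  assumes "n > 0" "l \<noteq> 0" "e > 0"
  obtains d where "d > 0" "\<And>w. cmod (w - l ^ n) < d \<Longrightarrow> \<exists>z. z ^ n = w \<and> cmod (z - l) < e"
proof -
  \<comment> \<open>Dividing by l^n moves the base point to 1, off the branch cut of
    \<open>Ln\<close>, so this branch of the root is continuous at l^n.\<close>
  define f where "f w = l * exp (Ln (w / l ^ n) / of_nat n)" for w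
  have "isCont f (l ^ n)"
    unfolding f_def using assms
    by (intro continuous_intros) (auto simp: complex_nonpos_Reals_iff)
  moreover have "f (l ^ n) = l" using assms by (simp add: f_def)
  ultimately obtain d where d: "d > 0" "\<And>w. dist w (l ^ n) < d \<Longrightarrow> dist (f w) l < e"
    using \<open>e > 0\<close> unfolding continuous_at_eps_delta by metis
  show ?thesis
  \<comment> \<open>The second bound keeps w away from 0, where \<open>Ln\<close> does not invert
    \<open>exp\<close>.\<close>
  proof (rule that[of "min d (cmod (l ^ n))"])
    show "min d (cmod (l ^ n)) > 0" using d assms by simp
    fix w assume w: "cmod (w - l ^ n) < min d (cmod (l ^ n))"
    then have "w \<noteq> 0" by (auto simp: norm_minus_commute)
    then have "f w ^ n = w"
      unfolding f_def using assms by (simp add: power_mult_distrib flip: exp_of_nat_mult)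
    moreover have "cmod (f w - l) < e" using d(2)[of w] w by (simp add: dist_norm)
    ultimately show "\<exists>z. z ^ n = w \<and> cmod (z - l) < e" by blast
  qed
qed

text \<open>The sum is geometric with ratio q, where q^n = 1 and q differs from 1 because n does not
  divide m.\<close>

lemma sum_root_of_unity_powers:
  assumes "0 < m" "m < n"
  shows "(\<Sum>j<n. cis (2 * pi * real j / real n) ^ m) = 0"
proof -
  define q where "q = cis (2 * pi * real m / real n)"
  have "cis (2 * pi * real j / real n) ^ m = q ^ j" for j
    unfolding q_def Complex.DeMoivre by (rule arg_cong[where f = cis]) simp
  moreover have "q ^ n = 1"
  proof -
    have "real n * (2 * pi * real m / real n) = 2 * pi * real m" using assms by simp
    then show ?thesis by (simp only: q_def Complex.DeMoivre) (rule cis_multiple_2pi, simp)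
  qed
  moreover have "q \<noteq> 1"
  proof
    assume "q = 1"
    then have "cos (2 * pi * real m / real n) = 1"
      unfolding q_def by (metis cis.simps(1) one_complex.simps(1))
    then obtain k :: int where "2 * pi * real m / real n = of_int k * 2 * pi"
      unfolding cos_one_2pi_int by blast
    then have "real m = of_int k * real n"
      using assms by (simp add: field_simps)
    then have "int m = k * int n" by (metis of_int_eq_iff of_int_mult of_int_of_nat_eq)
    then show False using assms
      by (metis dvd_triv_right int_dvd_int_iff nat_dvd_not_less)
  qed
  ultimately show ?thesis
    by (simp add: geometric_sum)
qed

locale normal_power =
  fixes A A' :: "'a::complex_hilbert \<Rightarrow> 'a" and n :: nat
  assumes adj: "adjoint_pair A A'"
    and comm: "A' ((A ^^ n) x) = (A ^^ n) (A' x)"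
    and n_pos: "n > 0"
begin

section \<open>The reducing eigenspace of the normal power\<close>

abbreviation "N \<equiv> A ^^ n"
abbreviation "N' \<equiv> A' ^^ n"

text \<open>This is the space M of the outline. It contains the kernel of A - z for every root of
  z^n = l^n.\<close>

definition eig :: "complex \<Rightarrow> 'a set" where
  "eig l = {x. N x = scaleC (l ^ n) x}"

lemma adjN: "adjoint_pair N N'" by (rule adjoint_pair_funpow[OF adj])
lemma adj_shift: "adjoint_pair (shift_op A l) (shift_op A' (cnj l))" by (rule adjoint_pair_shift[OF adj])

lemmas bops = adjoint_pairD(1,2)[OF adj]
lemmas linA = bounded_op_linear_simps[OF bops(1)]
lemmas linA' = bounded_op_linear_simps[OF bops(2)]
lemmas linN = bounded_op_linear_simps[OF adjoint_pairD(1)[OF adjN]]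
lemmas linN' = bounded_op_linear_simps[OF adjoint_pairD(2)[OF adjN]]

lemma A_N: "A (N x) = N (A x)" by (rule funpow_swap1)
lemma A'_N': "A' (N' x) = N' (A' x)" by (rule funpow_swap1)

text \<open>The adjoint form of \<open>comm\<close>, read off from inner products.\<close>

lemma A_N': "A (N' x) = N' (A x)"
proof -
  have "rip y (A (N' x)) = rip y (N' (A x))" for y
    by (simp add: adjoint_pairD(4)[OF adj, symmetric] adjoint_pairD(3)[OF adjN, symmetric] comm)
  from this[of "A (N' x) - N' (A x)"]
  have "rip (A (N' x) - N' (A x)) (A (N' x) - N' (A x)) = 0" by (simp add: rip_simps(4))
  then show ?thesis by (simp add: rip_self)
qed

lemma N_N': "N (N' x) = N' (N x)"
proof -
  have "(A ^^ k) (N' x) = N' ((A ^^ k) x)" for k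
    by (induction k) (simp_all add: A_N')
  then show ?thesis .
qed

text \<open>A normal operator and its adjoint have equal norms at each vector, hence equal kernels;
  here it is N - l^n. Through this the kernel of T' lies in the eigenspace as well, so T' is
  injective on the complement.\<close>

lemma eig_iff: "x \<in> eig l \<longleftrightarrow> N' x = scaleC (cnj l ^ n) x"
proof -
  define S where "S = shift_op N (l ^ n)"
  define S' where "S' = shift_op N' (cnj (l ^ n))"
  have S: "adjoint_pair S S'" unfolding S_def S'_def by (rule adjoint_pair_shift[OF adjN])
  have "S (S' x) = S' (S x)"
    unfolding S_def S'_def shift_op_def by (simp add: linN linN' N_N' scaleC_scaleC mult.commute
        scaleC.scale_right_diff_distrib)
  then have "(norm (S x))\<^sup>2 = (norm (S' x))\<^sup>2"
    unfolding rip_self[symmetric] adjoint_pairD(3)[OF S]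
    using adjoint_pairD(4)[OF S, of x "S' x"] by simp
  then have "S x = 0 \<longleftrightarrow> S' x = 0" by (metis norm_eq_zero power2_eq_iff_nonneg norm_ge_zero)
  then show ?thesis unfolding S_def S'_def shift_op_def eig_def by simp
qed

lemma eig_closed_subspace: "closed (eig l)" "subspace (eig l)"
proof -
  have "bounded_linear N" "bounded_linear (scaleC (l ^ n) :: 'a \<Rightarrow> 'a)"
    by (rule bounded_op_bounded_linear[OF adjoint_pairD(1)[OF adjN]]) (rule bounded_linear_scaleC)
  then show "closed (eig l)"
    unfolding eig_def by (intro closed_Collect_eq linear_continuous_on)
  show "subspace (eig l)"
    by (simp add: subspace_def eig_def linN scaleC_add_right scaleR_scaleC scaleC_scaleC mult.commute)
qed

lemmas V_closed_subspace = ortho_compl_closed_subspace[of "eig l" for l]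

lemma eig_shift: "x \<in> eig l \<Longrightarrow> shift_op A z x \<in> eig l"
  unfolding eig_def shift_op_def
  by (simp add: linN A_N[symmetric] linA scaleC.scale_right_diff_distrib scaleC_scaleC mult.commute)

lemma eig_shift': "x \<in> eig l \<Longrightarrow> shift_op A' z x \<in> eig l"
  unfolding eig_def shift_op_def
  by (simp add: linN comm[symmetric] linA' scaleC.scale_right_diff_distrib scaleC_scaleC mult.commute)

lemma V_shift: "x \<in> ortho_compl (eig l) \<Longrightarrow> shift_op A z x \<in> ortho_compl (eig l)"
  by (rule ortho_compl_invariant[OF adj_shift eig_shift'])

lemma V_shift': "x \<in> ortho_compl (eig l) \<Longrightarrow> shift_op A' z x \<in> ortho_compl (eig l)"
  using ortho_compl_invariant[OF adjoint_pair_sym[OF adj_shift[of "cnj z"]] eig_shift] by simp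

lemma eigen_funpow:
  assumes "bounded_op B" "shift_op B z x = 0"
  shows "(B ^^ k) x = scaleC (z ^ k) x"
  using assms(2) unfolding shift_op_def
  by (induction k) (simp_all add: scaleC_one bounded_op_linear_simps[OF assms(1)] scaleC_scaleC mult.commute)

lemma ker_shift: "shift_op A l x = 0 \<Longrightarrow> x \<in> eig l"
  unfolding eig_def using eigen_funpow[OF bops(1)] by blast

lemma ker_shift': "shift_op A' (cnj l) x = 0 \<Longrightarrow> x \<in> eig l"
  unfolding eig_iff using eigen_funpow[OF bops(2)] by blast

lemma V_inj: "x \<in> ortho_compl (eig l) \<Longrightarrow> shift_op A l x = 0 \<Longrightarrow> x = 0"
  using ortho_compl_disjoint ker_shift by blast

lemma V_inj': "x \<in> ortho_compl (eig l) \<Longrightarrow> shift_op A' (cnj l) x = 0 \<Longrightarrow> x = 0"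
  using ortho_compl_disjoint ker_shift' by blast

section \<open>Surjectivity on the complement; from upper semi-B-Weyl to isolated
  eigenvalues\<close>

lemma V_onto:
  assumes "bounded_below_on (ortho_compl (eig l)) (shift_op A l)"
  shows "shift_op A l ` ortho_compl (eig l) = ortho_compl (eig l)"
  by (rule bounded_below_imp_onto[OF adj_shift V_closed_subspace V_shift V_shift' assms V_inj'])

text \<open>Let P be the power with closed range. A vector y of V is the sum of P x and some s in
  the kernel of P'. As P' is injective on V, s lies in the eigenspace; comparing components in V
  shows that y is P of the V-part of x.\<close>

lemma V_onto_if_closed_range:
  assumes cl: "closed (range (shift_op A l ^^ Suc m))"
  shows "shift_op A l ` ortho_compl (eig l) = ortho_compl (eig l)"
proof
  define T where "T = shift_op A l"
  define T' where "T' = shift_op A' (cnj l)"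
  define V where "V = ortho_compl (eig l)"
  define P where "P = T ^^ Suc m"
  define P' where "P' = T' ^^ Suc m"
  have adjP: "adjoint_pair P P'"
    unfolding P_def P'_def T_def T'_def by (rule adjoint_pair_funpow[OF adj_shift])
  note linP = bounded_op_linear_simps[OF adjoint_pairD(1)[OF adjP]]
  note linP' = bounded_op_linear_simps[OF adjoint_pairD(2)[OF adjP]]
  have inv: "(T ^^ k) x \<in> eig l" "(T' ^^ k) x \<in> eig l" if "x \<in> eig l" for k x
    using that by (induction k) (simp_all add: T_def T'_def eig_shift eig_shift')
  have invV: "(T ^^ k) x \<in> V" "(T' ^^ k) x \<in> V" if "x \<in> V" for k x
    using that by (induction k) (simp_all add: T_def T'_def V_def V_shift V_shift')
  have inj: "x = 0" if "x \<in> V" "(T' ^^ k) x = 0" for k x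
    using that
  proof (induction k)
    case (Suc k)
    then show ?case using V_inj'[of "(T' ^^ k) x" l] invV(2)[of x k] unfolding V_def T'_def by simp
  qed simp
  show "shift_op A l ` ortho_compl (eig l) \<subseteq> ortho_compl (eig l)" using V_shift by blast
  have W: "closed (range P)" "subspace (range P)"
    using cl linear_subspace_image[OF bounded_linear.linear[OF bounded_op_bounded_linear[OF adjoint_pairD(1)[OF adjP]]] subspace_UNIV]
    unfolding P_def T_def by auto
  show "ortho_compl (eig l) \<subseteq> shift_op A l ` ortho_compl (eig l)"
  proof
    fix y assume y: "y \<in> ortho_compl (eig l)"
    obtain r s where rs: "y = r + s" "r \<in> range P" "\<And>u. u \<in> range P \<Longrightarrow> rip u s = 0"
      by (rule orthogonal_decomposition[OF W, of y]) auto
    obtain x where x: "r = P x" using rs(2) by blast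
    have "rip (P (P' s)) s = 0" using rs(3) by blast
    then have P's: "P' s = 0" by (simp add: adjoint_pairD(3)[OF adjP] rip_self)
    obtain s1 s2 where s: "s = s1 + s2" "s1 \<in> eig l" "s2 \<in> V"
      unfolding V_def by (rule ortho_compl_decomposition[OF eig_closed_subspace])
    obtain x1 x2 where x12: "x = x1 + x2" "x1 \<in> eig l" "x2 \<in> V"
      unfolding V_def by (rule ortho_compl_decomposition[OF eig_closed_subspace])
    \<comment> \<open>Both sides lie in complementary invariant subspaces, so both vanish.\<close>
    have "P' s2 = - P' s1" using P's unfolding s(1) linP' by (simp add: eq_neg_iff_add_eq_0 add.commute)
    moreover have "- P' s1 \<in> eig l" unfolding P'_def
      by (intro subspace_neg eig_closed_subspace inv s)
    moreover have "P' s2 \<in> V" unfolding P'_def by (rule invV(2)[OF s(3)])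
    ultimately have "P' s2 = 0" using ortho_compl_disjoint unfolding V_def by metis
    then have "s2 = 0" using inj[OF s(3)] unfolding P'_def by blast
    have "y - P x2 = P x1 + s1"
      unfolding rs(1) x x12(1) linP s(1) \<open>s2 = 0\<close> by simp
    moreover have "P x1 + s1 \<in> eig l" unfolding P_def by (intro subspace_add eig_closed_subspace inv s x12)
    moreover have "y - P x2 \<in> V"
      using y invV(1)[OF x12(3)] subspace_diff[OF V_closed_subspace(2)] unfolding P_def V_def by blast
    ultimately have "y - P x2 = 0" using ortho_compl_disjoint unfolding V_def by metis
    then have "y = T ((T ^^ m) x2)" by (simp add: P_def)
    then show "y \<in> shift_op A l ` ortho_compl (eig l)"
      using invV(1)[OF x12(3)] unfolding V_def T_def by blast
  qed
qed

text \<open>On the eigenspace the cofactor times A - z is A^n - z^n, the nonzero scalar l^n -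
  z^n.\<close>

lemma bounded_below_on_eig:
  assumes "z ^ n \<noteq> l ^ n"
  shows "bounded_below_on (eig l) (shift_op A z)"
proof (rule bounded_below_on_compose_right[OF bounded_op_power_quot[OF bops(1)]])
  show "bounded_below_on (eig l) (\<lambda>x. power_quot A z n (shift_op A z x))"
  proof (rule bounded_below_onI)
    show "cmod (l ^ n - z ^ n) > 0" using assms by simp
    fix x assume "x \<in> eig l"
    then have "power_quot A z n (shift_op A z x) = scaleC (l ^ n - z ^ n) x"
      unfolding power_quot_shift_commute[OF bops(1)] shift_power_quot[OF bops(1)]
      by (simp add: shift_op_def eig_def scaleC.scale_left_diff_distrib)
    then show "cmod (l ^ n - z ^ n) * norm x \<le> norm (power_quot A z n (shift_op A z x))"
      by (simp add: norm_scaleC)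
  qed
qed

text \<open>For l \<noteq> 0 the root l of z^n - l^n is simple. The two identities then split each x
  in the eigenspace into a part in the kernel of A - l and a part in its range.\<close>

lemma eig_shift_eq:
  assumes "x \<in> eig l"
  shows "scaleC (of_nat n * l ^ (n - 1)) x = power_quot A l n x - power_quot2 A l n (shift_op A l x)"
    "shift_op A l (power_quot A l n x) = 0"
  using power_quot_remainder[OF bops(1), of l n x, symmetric] assms shift_power_quot[OF bops(1)]
  by (simp_all add: eig_def shift_op_def)

text \<open>For l = 0 the eigenspace is the kernel of A^n and is trivial. Otherwise the kernel part
  in \<open>eig_shift_eq\<close> vanishes, and x is recovered boundedly from (A - l) x.\<close>

lemma bounded_below_on_eig_if_injective:
  assumes inj: "\<And>x. shift_op A l x = 0 \<Longrightarrow> x = 0"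
  shows "bounded_below_on (eig l) (shift_op A l)"
proof (cases "l = 0")
  case True
  have "x = 0" if "(A ^^ k) x = 0" for k x
    using that by (induction k) (use inj True in \<open>auto simp: shift_op_def\<close>)
  then have "eig l = {0}" using True n_pos by (auto simp: eig_def linN zero_power)
  then show ?thesis by (intro bounded_below_onI[of 1]) (auto simp: linA)
next
  case False
  define k where "k = of_nat n * l ^ (n - 1)"
  have k: "cmod k > 0" using False n_pos by (simp add: k_def)
  obtain C where C: "C > 0" "\<And>z x. cmod z \<le> cmod l \<Longrightarrow> norm (power_quot2 A z n x) \<le> C * norm x"
    by (rule power_quot2_bound[OF bops(1), of "cmod l" n]) auto
  show ?thesis
  proof (rule bounded_below_onI)
    show "cmod k / C > 0" using k C by simp
    fix x assume x: "x \<in> eig l"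
    then have "scaleC k x = - power_quot2 A l n (shift_op A l x)"
      using eig_shift_eq[OF x] inj unfolding k_def by simp
    then have "cmod k * norm x \<le> C * norm (shift_op A l x)"
      using C(2)[of l "shift_op A l x"] by (metis norm_minus_cancel norm_scaleC order_refl)
    then show "cmod k / C * norm x \<le> norm (shift_op A l x)" using C by (simp add: field_simps)
  qed
qed

lemma bounded_below_if:
  assumes "bounded_below_on (eig l) (shift_op A z)" "bounded_below_on (ortho_compl (eig l)) (shift_op A z)"
  shows "bounded_below (shift_op A z)"
  by (rule bounded_below_combine[OF eig_closed_subspace bounded_op_shift[OF bops(1)] eig_shift V_shift assms])

lemma upper_semi_B_Weyl_imp_Ea:
  assumes l: "l \<in> approx_point_spectrum A" and W: "upper_semi_B_Weyl (shift_op A l)"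
  shows "l \<in> Ea A"
proof -
  define V where "V = ortho_compl (eig l)"
  obtain m where "closed (shift_op A l ` range (shift_op A l ^^ m))"
    using W unfolding upper_semi_B_Weyl_def Let_def by blast
  then have "closed (range (shift_op A l ^^ Suc m))"
    by (simp add: image_comp)
  from V_onto_if_closed_range[OF this]
  have onto: "shift_op A l ` V = V" unfolding V_def .
  have bb: "bounded_below_on V (shift_op A l)"
    unfolding V_def by (rule bijective_imp_bounded_below[OF adj_shift V_closed_subspace V_shift' onto[unfolded V_def] V_inj])
  then obtain c where c: "c > 0" "\<And>x. x \<in> V \<Longrightarrow> c * norm x \<le> norm (shift_op A l x)"
    using bounded_below_onE by blast
  have "l isolated_in approx_point_spectrum A"
  proof (rule isolated_inI[OF l])
    \<comment> \<open>Within distance c of l a perturbation keeps A - z bounded below on V; removing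
      the finitely many other roots of z^n = l^n keeps it bounded below on the eigenspace.\<close>
    define U where "U = ball l c - ({z. z ^ n = l ^ n} - {l})"
    have "finite {z. z ^ n = l ^ n}"
      using n_pos by (rule finite_nth_roots)
    then show "open U" unfolding U_def by (intro open_Diff finite_imp_closed) auto
    have "z \<notin> approx_point_spectrum A" if z: "z \<in> U" "z \<noteq> l" for z
    proof -
      have "bounded_below_on V (shift_op A z)"
      proof (rule bounded_below_onI)
        show "c - cmod (z - l) > 0" using z by (auto simp: U_def dist_norm norm_minus_commute)
        fix x assume "x \<in> V"
        have "shift_op A l x = shift_op A z x + scaleC (z - l) x"
          by (simp add: shift_op_def scaleC.scale_left_diff_distrib)
        then have "norm (shift_op A l x) \<le> norm (shift_op A z x) + cmod (z - l) * norm x"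
          by (metis norm_scaleC norm_triangle_ineq)
        then show "(c - cmod (z - l)) * norm x \<le> norm (shift_op A z x)"
          using c(2)[OF \<open>x \<in> V\<close>] by (simp add: algebra_simps)
      qed
      moreover have "z ^ n \<noteq> l ^ n" using z by (auto simp: U_def)
      ultimately show ?thesis
        unfolding approx_point_spectrum_iff[OF bops(1)] not_not V_def
        using bounded_below_if bounded_below_on_eig by blast
    qed
    moreover have "l \<in> U" using c by (simp add: U_def)
    ultimately show "U \<inter> approx_point_spectrum A = {l}" using l by blast
  qed
  moreover have "l \<in> point_spectrum A"
  proof (rule ccontr)
    \<comment> \<open>Then A - l is injective, hence bounded below on the eigenspace as well as on
      V.\<close>
    assume "l \<notin> point_spectrum A"
    then have "x = 0" if "shift_op A l x = 0" for x
      using that unfolding point_spectrum_def shift_op_def by auto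
    then have "bounded_below (shift_op A l)"
      using bounded_below_if bounded_below_on_eig_if_injective bb unfolding V_def by blast
    then show False using l approx_point_spectrum_iff[OF bops(1)] by blast
  qed
  ultimately show ?thesis unfolding Ea_def by blast
qed

section \<open>From isolated points through a spectral gap to upper semi-B-Weyl\<close>

lemma bounded_below_near_isolated:
  assumes "l isolated_in approx_point_spectrum A"
  obtains r where "r > 0" "\<And>z. z \<noteq> l \<Longrightarrow> cmod (z - l) < r \<Longrightarrow> bounded_below (shift_op A z)"
proof -
  obtain r where r: "r > 0" "\<And>z. z \<in> approx_point_spectrum A \<Longrightarrow> dist l z < r \<Longrightarrow> z = l"
    using assms unfolding isolated_in_dist_Ex_iff by blast
  show ?thesis
    by (rule that[OF r(1)])
      (use r(2) in \<open>auto simp: approx_point_spectrum_iff[OF bops(1)] dist_norm norm_minus_commute\<close>)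
qed

text \<open>Near \<open>l \<noteq> 0\<close> the polynomial \<open>z\<^sup>n - w\<close> has a single root \<open>z\<close>, and the cofactor
  \<open>power_quot A z n\<close> is close to \<open>n z\<^bsup>n-1\<^esup>\<close> on approximate eigenvectors of \<open>A\<close>; so a joint
  approximate eigenvector of \<open>T' T\<close> and \<open>A\<^sup>n\<close> yields a point of the approximate spectrum of
  \<open>A\<close> near \<open>l\<close>, which has to be \<open>l\<close> itself.\<close>
lemma isolated_nonzero_imp_bounded_below:
  assumes iso: "l isolated_in approx_point_spectrum A" and l0: "l \<noteq> 0"
  shows "bounded_below_on (ortho_compl {x. shift_op A l x = 0}) (shift_op A l)"
proof -
  define T where "T = shift_op A l"
  define T' where "T' = shift_op A' (cnj l)"
  have T: "adjoint_pair T T'" unfolding T_def T'_def by (rule adj_shift)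
  \<comment> \<open>\<kappa> z is the value q(z) of the cofactor, and \<kappa>0 bounds its modulus
    from below for |z| at least |l| / 2.\<close>
  define \<kappa> where "\<kappa> z = of_nat n * z ^ (n - 1)" for z :: complex
  define \<kappa>0 where "\<kappa>0 = n * (cmod l / 2) ^ (n - 1)"
  have \<kappa>0: "\<kappa>0 > 0" using l0 n_pos by (simp add: \<kappa>0_def)
  have \<kappa>_low: "\<kappa>0 \<le> cmod (\<kappa> z)" if "cmod l / 2 \<le> cmod z" for z
    unfolding \<kappa>_def \<kappa>0_def norm_mult norm_power norm_of_nat
    using that by (intro mult_left_mono power_mono) auto
  obtain r0 where r0: "r0 > 0" "\<And>z. z \<noteq> l \<Longrightarrow> cmod (z - l) < r0 \<Longrightarrow> bounded_below (shift_op A z)"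
    using bounded_below_near_isolated[OF iso] by blast
  obtain C where C: "C > 0" "\<And>z x. cmod z \<le> cmod l + 1 \<Longrightarrow> norm (power_quot2 A z n x) \<le> C * norm x"
    by (rule power_quot2_bound[OF bops(1), of "cmod l + 1" n]) auto
  obtain L where L: "L > 0" "\<And>x. norm (power_quot A l n x) \<le> L * norm x"
    by (rule power_quot_bound[OF bops(1), of "cmod l" n]) auto
  have rem: "norm (power_quot A z n x - scaleC (\<kappa> z) x) \<le> C * norm (shift_op A z x)"
    if "cmod z \<le> cmod l + 1" for z x
    unfolding \<kappa>_def power_quot_remainder[OF bops(1)] using C(2)[OF that] .
  have NT: "norm (shift_op N (l ^ n) x) \<le> L * norm (T x)" for x
    using L(2)[of "T x"]
    unfolding T_def power_quot_shift_commute[OF bops(1)] shift_power_quot[OF bops(1)] .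
  \<comment> \<open>In order: z stays in the punctured disc free of spectrum, in the disc where C is
    valid, away from 0, and so close to l that its share of the cofactor error is at most \<kappa>0
    / 4.\<close>
  define \<rho> where "\<rho> = Min {r0, 1, cmod l / 2, \<kappa>0 / (4 * C)}"
  have \<rho>: "\<rho> > 0" "\<rho> \<le> r0" "\<rho> \<le> 1" "\<rho> \<le> cmod l / 2" "\<rho> \<le> \<kappa>0 / (4 * C)"
    using r0(1) l0 \<kappa>0 C(1) by (auto simp: \<rho>_def)
  obtain \<eta> where \<eta>: "\<eta> > 0" "\<And>w. cmod (w - l ^ n) < \<eta> \<Longrightarrow> \<exists>z. z ^ n = w \<and> cmod (z - l) < \<rho>"
    using complex_nth_root_near[OF n_pos l0 \<rho>(1)] by blast
  \<comment> \<open>q will bound |T y| on the joint approximate eigenvectors. The first term limits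
    the cofactor error, the second keeps w within \<eta> of l^n.\<close>
  define q where "q = min (\<kappa>0 / (4 * C)) (\<eta> / (2 * L))"
  have q: "q > 0" "C * q \<le> \<kappa>0 / 4" "L * q < \<eta>"
  proof -
    show "q > 0" using \<kappa>0 C(1) L(1) \<eta>(1) by (simp add: q_def)
    have "C * q \<le> C * (\<kappa>0 / (4 * C))" unfolding q_def using C(1) by (intro mult_left_mono) auto
    then show "C * q \<le> \<kappa>0 / 4" using C(1) by simp
    have "L * q \<le> L * (\<eta> / (2 * L))" unfolding q_def using L(1) by (intro mult_left_mono) auto
    then show "L * q < \<eta>" using L(1) \<eta>(1) by simp
  qed
  define D where "D = (\<lambda>x. T' (T x))"
  have D: "adjoint_pair D D"
    unfolding D_def by (rule adjoint_pair_compose[OF adjoint_pair_sym[OF T] T])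
  have DN: "D (N x) = N (D x)" for x
    unfolding D_def T_def T'_def shift_op_def
    by (simp add: linN linA linA' A_N comm scaleC.scale_right_diff_distrib)
  have DN': "D (N' x) = N' (D x)" for x
    unfolding D_def T_def T'_def shift_op_def
    by (simp add: linN' linA linA' A_N' A'_N' scaleC.scale_right_diff_distrib)
  have "bounded_below (\<lambda>x. D x - c *\<^sub>R x)" if c: "0 < c" "c < q\<^sup>2 / 2" for c
  proof (rule ccontr)
    assume "\<not> bounded_below (\<lambda>x. D x - c *\<^sub>R x)"
    then obtain w where w: "\<And>e. e > 0 \<Longrightarrow>
        \<exists>x. norm x = 1 \<and> norm (D x - c *\<^sub>R x) < e \<and> norm (shift_op N w x) < e"
      by (rule joint_approximate_eigenvalue_normal[OF adjN N_N' D DN DN']) auto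
    have Tsmall: "norm (T y) \<le> q" if "norm y = 1" "norm (D y - c *\<^sub>R y) < e" "e \<le> c" for y e
    proof -
      have "(norm (T y))\<^sup>2 = rip (D y - c *\<^sub>R y) y + c"
        using adjoint_pairD(4)[OF T, of "T y" y] that(1) by (simp add: D_def rip_simps rip_self)
      also have "\<dots> \<le> norm (D y - c *\<^sub>R y) + c"
        using rip_cauchy_schwarz[of "D y - c *\<^sub>R y" y] that(1) by simp
      also have "\<dots> \<le> q\<^sup>2" using that c by simp
      finally show ?thesis by (rule power2_le_imp_le) (use q(1) in simp)
    qed
    have "cmod (w - l ^ n) \<le> L * q"
    proof (rule field_le_epsilon)
      fix e :: real assume "e > 0"
      then obtain y where y: "norm y = 1" "norm (D y - c *\<^sub>R y) < min e c" "norm (shift_op N w y) < min e c"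
        using w[of "min e c"] c by auto
      have "norm (T y) \<le> q" using Tsmall[OF y(1,2)] by simp
      then have "norm (shift_op N (l ^ n) y) \<le> L * q"
        using NT[of y] L(1) by (meson mult_left_mono less_imp_le order_trans)
      moreover have "scaleC (w - l ^ n) y = shift_op N (l ^ n) y - shift_op N w y"
        by (simp add: shift_op_def scaleC.scale_left_diff_distrib)
      then have "cmod (w - l ^ n) \<le> norm (shift_op N (l ^ n) y) + norm (shift_op N w y)"
        using y(1) by (metis mult.right_neutral norm_scaleC norm_triangle_ineq4)
      ultimately show "cmod (w - l ^ n) \<le> L * q + e" using y(3) by simp
    qed
    then have "cmod (w - l ^ n) < \<eta>" using q(3) by linarith
    then obtain z where z: "z ^ n = w" "cmod (z - l) < \<rho>" using \<eta>(2) by blast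
    have z_bounds: "cmod z \<le> cmod l + 1" "cmod l / 2 \<le> cmod z"
      using z(2) \<rho>(3,4) norm_triangle_ineq2[of z l] norm_triangle_ineq2[of l z]
      by (auto simp: norm_minus_commute)
    \<comment> \<open>The cofactor image of y is mapped by A - z to the small vector (N - w) y, but
      it is close to \<kappa> z times y and so not small itself.\<close>
    have "\<not> bounded_below (shift_op A z)"
    proof
      assume "bounded_below (shift_op A z)"
      then obtain b where b: "b > 0" "\<And>x. b * norm x \<le> norm (shift_op A z x)"
        using bounded_below_onE by (metis UNIV_I)
      define e where "e = min c (b * \<kappa>0 / 4)"
      have "e > 0" using c b \<kappa>0 by (simp add: e_def)
      then obtain y where y: "norm y = 1" "norm (D y - c *\<^sub>R y) < e" "norm (shift_op N w y) < e"
        using w by blast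
      have "b * norm (power_quot A z n y) \<le> norm (shift_op N w y)"
        using b(2)[of "power_quot A z n y"] unfolding shift_power_quot[OF bops(1)] z(1) .
      also have "\<dots> \<le> b * (\<kappa>0 / 4)" using y(3) by (simp add: e_def)
      finally have Q: "norm (power_quot A z n y) \<le> \<kappa>0 / 4" using b(1) by simp
      have "shift_op A z y = T y - scaleC (z - l) y"
        by (simp add: T_def shift_op_def scaleC.scale_left_diff_distrib)
      then have "norm (shift_op A z y) \<le> norm (T y) + cmod (z - l)"
        using y(1) by (metis mult.right_neutral norm_scaleC norm_triangle_ineq4)
      also have "\<dots> < q + \<rho>" using Tsmall[OF y(1,2)] z(2) by (simp add: e_def)
      finally have "C * norm (shift_op A z y) < C * (q + \<rho>)" using C(1) by simp
      moreover have "C * \<rho> \<le> \<kappa>0 / 4" using \<rho>(5) C(1) by (simp add: field_simps)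
      ultimately have "norm (power_quot A z n y - scaleC (\<kappa> z) y) < \<kappa>0 / 2"
        using rem[OF z_bounds(1), of y] q(2) by (simp add: algebra_simps)
      moreover have "cmod (\<kappa> z) \<le> norm (power_quot A z n y) + norm (power_quot A z n y - scaleC (\<kappa> z) y)"
        using norm_triangle_ineq4[of "power_quot A z n y" "power_quot A z n y - scaleC (\<kappa> z) y"] y(1)
        by (simp add: norm_scaleC)
      ultimately show False using Q \<kappa>_low[OF z_bounds(2)] \<kappa>0 by linarith
    qed
    then have "z = l" using r0(2)[of z] z(2) \<rho>(2) by force
    then have wl: "w = l ^ n" using z by simp
    have \<kappa>l: "\<kappa>0 \<le> cmod (\<kappa> l)" "\<kappa> l \<noteq> 0" using \<kappa>_low[of l] \<kappa>0 by auto
    \<comment> \<open>Chosen so that the error e (q + L) / \<kappa>0 in the estimate of c times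
      \<open>rip y Y\<close> is at most c / 2.\<close>
    define e where "e = min c (\<kappa>0 * c / (2 * (q + L)))"
    have e: "e > 0" "e \<le> c" "e * (q + L) \<le> \<kappa>0 * c / 2"
    proof -
      show "e > 0" using c \<kappa>0 q L by (simp add: e_def)
      have "e * (q + L) \<le> \<kappa>0 * c / (2 * (q + L)) * (q + L)"
        unfolding e_def using q(1) L(1) by (intro mult_right_mono) auto
      also have "\<dots> = \<kappa>0 * c / 2"
      proof -
        have "x / (2 * s) * s = x / 2" if "s > 0" for x s :: real using that by simp
        then show ?thesis using q(1) L(1) by (meson add_pos_pos)
      qed
      finally show "e * (q + L) \<le> \<kappa>0 * c / 2" .
    qed (simp add: e_def)
    obtain y where y: "norm y = 1" "norm (D y - c *\<^sub>R y) < e" "norm (shift_op N (l ^ n) y) < e"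
      using w[OF e(1)] wl by blast
    have Ty: "norm (T y) \<le> q" using Tsmall[OF y(1,2) e(2)] .
    \<comment> \<open>Y is y up to an error of 1/4, yet T Y is small because T times the cofactor is
      N - l^n. As D y is nearly c y, the product of y and Y is nearly that of T y and T Y divided by
      c; it is thus at most 1/2, whereas closeness to y makes it at least 3/4.\<close>
    define Y where "Y = scaleC (1 / \<kappa> l) (power_quot A l n y)"
    have inv\<kappa>: "cmod (1 / \<kappa> l) \<le> 1 / \<kappa>0"
      using \<kappa>l \<kappa>0 by (simp add: norm_divide frac_le)
    have Y: "norm Y \<le> 1 / \<kappa>0 * L"
      unfolding Y_def norm_scaleC using L(2)[of y] y(1) \<kappa>0 inv\<kappa> by (intro mult_mono) auto
    have "T Y = scaleC (1 / \<kappa> l) (shift_op N (l ^ n) y)"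
      unfolding Y_def T_def bounded_op_scaleC[OF bounded_op_shift[OF bops(1)]] shift_power_quot[OF bops(1)] ..
    then have TY: "norm (T Y) \<le> 1 / \<kappa>0 * e"
      using y(3) \<kappa>0 inv\<kappa> by (auto simp only: norm_scaleC intro!: mult_mono) auto
    have "c * rip y Y = rip (T y) (T Y) - rip (D y - c *\<^sub>R y) Y"
      using adjoint_pairD(4)[OF T, of "T y" Y] by (simp add: D_def rip_simps)
    also have "\<dots> \<le> norm (T y) * norm (T Y) + norm (D y - c *\<^sub>R y) * norm Y"
      using rip_cauchy_schwarz[of "T y" "T Y"] rip_cauchy_schwarz[of "D y - c *\<^sub>R y" Y] by linarith
    also have "\<dots> \<le> q * (1 / \<kappa>0 * e) + e * (1 / \<kappa>0 * L)"
      using Ty TY Y y(2) q(1) e(1) by (intro add_mono mult_mono) auto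
    also have "\<dots> = e * (q + L) / \<kappa>0" by (simp add: algebra_simps add_divide_distrib)
    also have "\<dots> \<le> (\<kappa>0 * c / 2) / \<kappa>0" using e(3) \<kappa>0 by (intro divide_right_mono) auto
    also have "\<dots> = c * (1 / 2)" using \<kappa>0 by simp
    finally have 1: "rip y Y \<le> 1 / 2" using c(1) by simp
    have "y - Y = scaleC (1 / \<kappa> l) (scaleC (\<kappa> l) y - power_quot A l n y)"
      unfolding Y_def using \<kappa>l(2) by (simp add: scaleC.scale_right_diff_distrib scaleC_scaleC scaleC_one)
    moreover have "norm (scaleC (\<kappa> l) y - power_quot A l n y) \<le> C * q"
    proof -
      have "norm (power_quot A l n y - scaleC (\<kappa> l) y) \<le> C * norm (T y)"
        using rem[of l y] unfolding T_def by simp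
      also have "\<dots> \<le> C * q" using Ty C(1) by (intro mult_left_mono) auto
      finally show ?thesis by (simp add: norm_minus_commute)
    qed
    ultimately have "norm (y - Y) \<le> 1 / \<kappa>0 * (C * q)"
      using inv\<kappa> \<kappa>0 by (auto simp only: norm_scaleC intro!: mult_mono) auto
    also have "\<dots> \<le> 1 / \<kappa>0 * (\<kappa>0 / 4)" using q(2) \<kappa>0 by (intro mult_left_mono) auto
    finally have "norm (y - Y) \<le> 1 / 4" using \<kappa>0 by simp
    then have "rip y (y - Y) \<le> 1 / 4" using rip_cauchy_schwarz[of y "y - Y"] y(1) by simp
    with 1 show False using y(1) by (simp add: rip_simps rip_self)
  qed
  then have "bounded_below_on (ortho_compl {x. T x = 0}) T"
    using spectral_gap_imp_bounded_below[OF T, of "q\<^sup>2 / 2"] q(1) unfolding D_def by simp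
  then show ?thesis unfolding T_def .
qed

text \<open>Averaging \<open>z power_quot A z n\<close> over the roots of \<open>z\<^sup>n = w\<close> gives \<open>n w\<close> times the identity.\<close>
lemma approximate_eigenvalue_nth_root:
  assumes w: "w \<noteq> 0" and nbb: "\<not> bounded_below (shift_op N w)"
  obtains z where "z ^ n = w" "\<not> bounded_below (shift_op A z)"
proof (rule ccontr)
  note found = that
  assume "\<not> thesis"
  then have bb: "bounded_below (shift_op A z)" if "z ^ n = w" for z using found that by blast
  obtain z0 where z0: "z0 ^ n = w" using complex_nth_root_exists[OF n_pos] by blast
  define z where "z j = z0 * cis (2 * pi * real j / real n)" for j :: nat
  have z: "z j ^ n = w" for j
  proof -
    have "cis (2 * pi * real j / real n) ^ n = 1"
    proof -
      have "real n * (2 * pi * real j / real n) = 2 * pi * real j" using n_pos by simp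
      then show ?thesis by (simp only: Complex.DeMoivre) (rule cis_multiple_2pi, simp)
    qed
    then show ?thesis by (simp add: z_def power_mult_distrib z0)
  qed
  \<comment> \<open>The coefficient of A^i is the sum of the powers z_j^(n-i), which vanishes unless
    i = 0, where each summand is w.\<close>
  have avg: "(\<Sum>j<n. scaleC (z j) (power_quot A (z j) n y)) = scaleC (of_nat n * w) y" for y
  proof -
    have "(\<Sum>j<n. scaleC (z j) (power_quot A (z j) n y))
        = (\<Sum>j<n. \<Sum>i<n. scaleC (z j ^ (n - i)) ((A ^^ i) y))"
      unfolding power_quot_def scaleC.scale_sum_right scaleC_scaleC
    proof (intro sum.cong refl)
      fix i j assume "i \<in> {..<n}"
      then have "n - i = Suc (n - Suc i)" by auto
      then show "scaleC (z j * z j ^ (n - Suc i)) ((A ^^ i) y) = scaleC (z j ^ (n - i)) ((A ^^ i) y)" by simp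
    qed
    also have "\<dots> = (\<Sum>i<n. scaleC (\<Sum>j<n. z j ^ (n - i)) ((A ^^ i) y))"
      by (subst sum.swap) (simp add: scaleC.scale_sum_left)
    also have "\<dots> = (\<Sum>i<n. if i = 0 then scaleC (of_nat n * w) y else 0)"
    proof (intro sum.cong refl)
      fix i assume i: "i \<in> {..<n}"
      have "(\<Sum>j<n. z j ^ (n - i)) = 0" if "i \<noteq> 0"
        unfolding z_def power_mult_distrib sum_distrib_left[symmetric]
        using sum_root_of_unity_powers[of "n - i" n] i that by simp
      then show "scaleC (\<Sum>j<n. z j ^ (n - i)) ((A ^^ i) y) = (if i = 0 then scaleC (of_nat n * w) y else 0)"
        by (simp add: z)
    qed
    also have "\<dots> = scaleC (of_nat n * w) y" using n_pos by simp
    finally show ?thesis .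
  qed
  have "\<exists>b>0. \<forall>x. b * norm x \<le> norm (shift_op A (z j) x)" for j
    using bb[OF z] unfolding bounded_below_on_def by simp
  then obtain b where b: "\<And>j. b j > 0" "\<And>j x. b j * norm x \<le> norm (shift_op A (z j) x)" by metis
  define S where "S = (\<Sum>j<n. cmod (z j) / b j)"
  have S: "S \<ge> 0" unfolding S_def using b(1) by (intro sum_nonneg) (simp add: less_imp_le)
  \<comment> \<open>If every A - z_j is bounded below, the average has norm at most S e on y, and
    this e makes S e smaller than n |w|.\<close>
  define e where "e = n * cmod w / (S + 1)"
  have "e > 0" using w n_pos S by (simp add: e_def)
  then obtain y where y: "norm y = 1" "norm (shift_op N w y) < e"
    using not_bounded_below_unit[OF bounded_op_shift[OF adjoint_pairD(1)[OF adjN]] nbb] by blast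
  have "n * cmod w = norm (\<Sum>j<n. scaleC (z j) (power_quot A (z j) n y))"
    unfolding avg by (simp add: norm_scaleC norm_mult y(1))
  also have "\<dots> \<le> (\<Sum>j<n. cmod (z j) / b j * norm (shift_op N w y))"
  proof (rule sum_norm_le)
    fix j
    have "b j * norm (power_quot A (z j) n y) \<le> norm (shift_op N w y)"
      using b(2)[of j "power_quot A (z j) n y"] unfolding shift_power_quot[OF bops(1)] z .
    then have "norm (power_quot A (z j) n y) \<le> norm (shift_op N w y) / b j"
      using b(1)[of j] by (simp add: field_simps)
    then have "cmod (z j) * norm (power_quot A (z j) n y) \<le> cmod (z j) * (norm (shift_op N w y) / b j)"
      by (rule mult_left_mono) simp
    then show "norm (scaleC (z j) (power_quot A (z j) n y)) \<le> cmod (z j) / b j * norm (shift_op N w y)"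
      by (simp add: norm_scaleC)
  qed
  also have "\<dots> = S * norm (shift_op N w y)" by (simp add: S_def sum_distrib_right)
  also have "\<dots> \<le> S * e" using S y(2) by (intro mult_left_mono) auto
  also have "\<dots> < (S + 1) * e" using \<open>e > 0\<close> by simp
  also have "\<dots> = n * cmod w" using S by (simp add: e_def)
  finally show False by simp
qed

text \<open>At 0 the n roots merge and the cofactor value n z^(n-1) degenerates, so the gap is shown
  for N' N. A small c > 0 would give a small nonzero w, and one of its roots would be a nonzero
  point of the approximate spectrum near 0.\<close>

lemma isolated_zero_imp_bounded_below:
  assumes iso: "0 isolated_in approx_point_spectrum A"
  shows "bounded_below_on (ortho_compl {x. N x = 0}) N"
proof -
  obtain r0 where r0: "r0 > 0" "\<And>z. z \<noteq> 0 \<Longrightarrow> cmod z < r0 \<Longrightarrow> bounded_below (shift_op A z)"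
    using bounded_below_near_isolated[OF iso] by auto
  define D where "D = (\<lambda>x. N' (N x))"
  have D: "adjoint_pair D D"
    unfolding D_def by (rule adjoint_pair_compose[OF adjoint_pair_sym[OF adjN] adjN])
  have DN: "D (N x) = N (D x)" "D (N' x) = N' (D x)" for x
    unfolding D_def by (simp_all add: N_N')
  obtain K where K: "K > 0" "\<And>x. norm (N' x) \<le> K * norm x"
    using bounded_op_bound[OF adjoint_pairD(2)[OF adjN]] by blast
  define q where "q = min 1 (r0 ^ n / 4)"
  have q: "q > 0" "q \<le> 1" "q \<le> r0 ^ n / 4" using r0(1) by (auto simp: q_def)
  have q2: "q\<^sup>2 \<le> q" using q(1,2) by (simp add: power2_eq_square mult_left_le)
  have "bounded_below (\<lambda>x. D x - c *\<^sub>R x)" if c: "0 < c" "c < q\<^sup>2 / 2" for c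
  proof (rule ccontr)
    assume "\<not> bounded_below (\<lambda>x. D x - c *\<^sub>R x)"
    then obtain w where w: "\<And>e. e > 0 \<Longrightarrow>
        \<exists>x. norm x = 1 \<and> norm (D x - c *\<^sub>R x) < e \<and> norm (shift_op N w x) < e"
      by (rule joint_approximate_eigenvalue_normal[OF adjN N_N' D DN]) auto
    \<comment> \<open>For w = 0 the vectors N y, and with them N' (N y), become arbitrarily small,
      against the approximate eigenvalue c > 0.\<close>
    have "w \<noteq> 0"
    proof
      assume "w = 0"
      define e where "e = c / (2 * (K + 1))"
      have "e > 0" using c K by (simp add: e_def)
      then obtain y where y: "norm y = 1" "norm (D y - c *\<^sub>R y) < e" "norm (N y) < e"
        using w[of e] \<open>w = 0\<close> by (auto simp: shift_op_def)
      have "c = norm (D y - (D y - c *\<^sub>R y))" using y(1) c by simp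
      also have "\<dots> \<le> norm (D y) + norm (D y - c *\<^sub>R y)" by (rule norm_triangle_ineq4)
      also have "norm (D y) \<le> K * norm (N y)" unfolding D_def by (rule K(2))
      also have "K * norm (N y) \<le> K * e" using y(3) K(1) by (intro mult_left_mono) auto
      finally have "c \<le> (K + 1) * e" using y(2) by (simp add: algebra_simps)
      also have "\<dots> = c / 2" using K(1) by (simp add: e_def field_simps)
      finally show False using c(1) by simp
    qed
    have "cmod w < r0 ^ n"
    proof -
      obtain y where y: "norm y = 1" "norm (D y - c *\<^sub>R y) < c" "norm (shift_op N w y) < c"
        using w[OF c(1)] by blast
      have "(norm (N y))\<^sup>2 = rip (D y - c *\<^sub>R y) y + c"
        using adjoint_pairD(4)[OF adjN, of "N y" y] y(1) by (simp add: D_def rip_simps rip_self)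
      also have "\<dots> \<le> norm (D y - c *\<^sub>R y) + c"
        using rip_cauchy_schwarz[of "D y - c *\<^sub>R y" y] y(1) by simp
      also have "\<dots> \<le> q\<^sup>2" using y(2) c by simp
      finally have "norm (N y) \<le> q" by (rule power2_le_imp_le) (use q(1) in simp)
      moreover have "cmod w \<le> norm (N y) + norm (shift_op N w y)"
        using norm_triangle_ineq4[of "N y" "shift_op N w y"] y(1) by (simp add: shift_op_def norm_scaleC)
      ultimately have "cmod w < 2 * q" using y(3) c(2) q2 q(1) by linarith
      then show ?thesis using q(1,3) by linarith
    qed
    have "\<not> bounded_below (shift_op N w)"
    proof
      assume "bounded_below (shift_op N w)"
      then obtain b where "b > 0" "\<And>x. b * norm x \<le> norm (shift_op N w x)"
        using bounded_below_onE by (metis UNIV_I)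
      then show False using w[of b] by (metis mult.right_neutral not_le)
    qed
    then obtain z where z: "z ^ n = w" "\<not> bounded_below (shift_op A z)"
      using approximate_eigenvalue_nth_root[OF \<open>w \<noteq> 0\<close>] by blast
    have "cmod z ^ n < r0 ^ n" using \<open>cmod w < r0 ^ n\<close> z(1) by (simp flip: norm_power)
    then have "cmod z < r0" by (rule power_less_imp_less_base) (use r0(1) in simp)
    moreover have "z \<noteq> 0" using z(1) \<open>w \<noteq> 0\<close> n_pos by (auto simp: zero_power)
    ultimately show False using r0(2) z(2) by blast
  qed
  then show ?thesis
    using spectral_gap_imp_bounded_below[OF adjN, of "q\<^sup>2 / 2"] q(1) unfolding D_def by simp
qed

text \<open>For l = 0 the power m = n works: the range of N is V, where A is bijective. For l
  \<noteq> 0 already m = 1 works: l is a simple root, so on the eigenspace T acts bijectively on its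
  own range, as it does on V.\<close>

lemma isolated_imp_upper_semi_B_Weyl:
  assumes iso: "l isolated_in approx_point_spectrum A"
  shows "upper_semi_B_Weyl (shift_op A l)"
proof (cases "l = 0")
  case True
  define V where "V = ortho_compl (eig 0)"
  have eig0: "eig 0 = {x. N x = 0}" using n_pos by (simp add: eig_def zero_power)
  have A0: "shift_op A 0 = A" by (simp add: shift_op_def fun_eq_iff)
  have "bounded_below_on V N"
    using isolated_zero_imp_bounded_below iso True unfolding V_def eig0 by simp
  moreover have "N = (\<lambda>x. (A ^^ (n - 1)) (A x))"
  proof (rule ext)
    show "N x = (A ^^ (n - 1)) (A x)" for x
      using funpow_Suc_right[of "n - 1" A] n_pos by simp
  qed
  ultimately have "bounded_below_on V (\<lambda>x. (A ^^ (n - 1)) (A x))" by metis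
  then have "bounded_below_on V A"
    by (rule bounded_below_on_compose_right[OF bounded_op_funpow[OF bops(1)]])
  then have onto: "A ` V = V" using V_onto[of 0] unfolding V_def A0 by blast
  have ontok: "(A ^^ k) ` V = V" for k
  proof (induction k)
    case (Suc k)
    have "(A ^^ Suc k) ` V = A ` (A ^^ k) ` V" by (simp add: image_image)
    then show ?case using Suc.IH onto by simp
  qed simp
  \<comment> \<open>N annihilates the eigenspace at 0 and maps V onto itself.\<close>
  have range: "range N = V"
  proof
    show "range N \<subseteq> V"
    proof clarify
      fix x
      obtain u v where "x = u + v" "u \<in> eig 0" "v \<in> V"
        unfolding V_def by (rule ortho_compl_decomposition[OF eig_closed_subspace])
      then have "N x = N v" by (simp add: linN eig0)
      then show "N x \<in> V" using ontok[of n] \<open>v \<in> V\<close> by blast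
    qed
    show "V \<subseteq> range N" using ontok[of n] by blast
  qed
  show ?thesis
    unfolding True A0
  proof (rule upper_semi_B_Weyl_if_bijective_on_range[where T = A and m = n])
    show "closed (range N)" unfolding range V_def by (rule V_closed_subspace)
    show "range N \<subseteq> A ` range N" unfolding range onto ..
    show "N x = 0" if "A (N x) = 0" for x
      using V_inj[of "N x" 0] that range unfolding V_def A0 by blast
  qed (rule bops)
next
  case False
  define T where "T = shift_op A l"
  define V where "V = ortho_compl (eig l)"
  define k where "k = of_nat n * l ^ (n - 1)"
  have k: "k \<noteq> 0" using False n_pos by (simp add: k_def)
  have T: "bounded_op T" unfolding T_def by (rule bounded_op_shift[OF bops(1)])
  note linT = bounded_op_linear_simps[OF T]
  have bb: "bounded_below_on (ortho_compl {x. T x = 0}) T"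
    using isolated_nonzero_imp_bounded_below[OF iso False] unfolding T_def .
  have sub: "V \<subseteq> ortho_compl {x. T x = 0}"
    unfolding V_def by (rule ortho_compl_antimono) (use ker_shift in \<open>auto simp: T_def\<close>)
  have onto: "T ` V = V"
    unfolding T_def V_def
    by (rule V_onto) (use bounded_below_on_mono[OF bb sub] in \<open>simp add: T_def V_def\<close>)
  \<comment> \<open>Applying T to the splitting of u removes the kernel part. The first form shows T
    u in the range of T^2, the second that T u vanishes with T^2 u.\<close>
  have eigT: "scaleC k (T u) = - T (T (power_quot2 A l n u))"
    "scaleC k (T u) = - power_quot2 A l n (T (T u))" if "u \<in> eig l" for u
  proof -
    have "scaleC k (T u) = T (power_quot A l n u) - T (power_quot2 A l n (T u))"
      using eig_shift_eq(1)[OF that] unfolding k_def T_def[symmetric] linT(6)[symmetric] by (simp add: linT)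
    also have "T (power_quot A l n u) = 0" using eig_shift_eq(2)[OF that] by (simp add: T_def)
    finally show "scaleC k (T u) = - T (T (power_quot2 A l n u))"
      "scaleC k (T u) = - power_quot2 A l n (T (T u))"
      unfolding T_def power_quot_shift_commute[OF bops(1)] by simp_all
  qed
  show ?thesis
    unfolding T_def[symmetric]
  proof (rule upper_semi_B_Weyl_if_bijective_on_range[where T = T and m = 1])
    \<comment> \<open>Components in the kernel do not contribute, and on the complement of the
      kernel T is bounded below, so the range is closed.\<close>
    have "range T = T ` ortho_compl {x. T x = 0}"
    proof
      have K: "closed {x. T x = 0}" "subspace {x. T x = 0}"
        by (intro closed_Collect_eq continuous_intros linear_continuous_on bounded_op_bounded_linear T)
          (simp add: subspace_def linT)
      show "range T \<subseteq> T ` ortho_compl {x. T x = 0}"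
      proof clarify
        fix x
        obtain u v where "x = u + v" "u \<in> {x. T x = 0}" "v \<in> ortho_compl {x. T x = 0}"
          by (rule ortho_compl_decomposition[OF K])
        then show "T x \<in> T ` ortho_compl {x. T x = 0}" by (simp add: linT)
      qed
    qed blast
    then show "closed (range (T ^^ 1))"
      using closed_image_bounded_below[OF T ortho_compl_closed_subspace bb] by simp
    show "range (T ^^ 1) \<subseteq> T ` range (T ^^ 1)"
    proof clarsimp
      fix x
      obtain u v where uv: "x = u + v" "u \<in> eig l" "v \<in> V"
        unfolding V_def by (rule ortho_compl_decomposition[OF eig_closed_subspace])
      obtain v' where v': "v = T v'" using onto uv(3) by blast
      have "T u = scaleC (1 / k) (scaleC k (T u))" using k by (simp add: scaleC_scaleC scaleC_one)
      also have "\<dots> = T (T (- scaleC (1 / k) (power_quot2 A l n u)))"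
        unfolding eigT(1)[OF uv(2)] by (simp add: linT)
      finally have "T x = T (T (- scaleC (1 / k) (power_quot2 A l n u) + v'))"
        unfolding uv(1) linT(1) v' by simp
      then show "T x \<in> T ` range T" by blast
    qed
    show "(T ^^ 1) x = 0" if "T ((T ^^ 1) x) = 0" for x
    proof -
      obtain u v where uv: "x = u + v" "u \<in> eig l" "v \<in> V"
        unfolding V_def by (rule ortho_compl_decomposition[OF eig_closed_subspace])
      have TT: "T (T u) + T (T v) = 0" using that unfolding uv(1) by (simp add: linT)
      \<comment> \<open>The two summands lie in complementary subspaces and add up to 0, so each is
        0; on V injectivity of T finishes, on the eigenspace \<open>eigT\<close> does.\<close>
      have "T (T u) \<in> eig l" "T (T v) \<in> V"
        using uv(2,3) unfolding T_def V_def by (auto intro: eig_shift V_shift)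
      moreover have "T (T v) = - T (T u)" using TT by (simp add: eq_neg_iff_add_eq_0 add.commute)
      ultimately have "T (T v) = 0"
        using ortho_compl_disjoint subspace_neg[OF eig_closed_subspace(2)] unfolding V_def by metis
      then have "T v = 0"
        using V_inj[of "T v" l] V_shift[of v l l] uv(3) unfolding V_def T_def by blast
      have "T (T u) = 0" using TT \<open>T (T v) = 0\<close> by simp
      then have "scaleC k (T u) = 0"
        unfolding eigT(2)[OF uv(2)]
        by (simp add: bounded_op_linear_simps[OF bounded_op_power_quot2[OF bops(1)]])
      then have "T u = 0" using k by simp
      then show ?thesis using \<open>T v = 0\<close> uv(1) by (simp add: linT)
    qed
  qed (rule T)
qed

end

theorem theorem3p8:
  fixes A :: "'a::complex_hilbert \<Rightarrow> 'a" and n :: nat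
  assumes "infinite_dimensional TYPE('a)"
    and "n > 1"
    and "bounded_op A"
    and "op_adjoint A \<circ> (A ^^ n) = (A ^^ n) \<circ> op_adjoint A"
  shows "approx_point_spectrum A - upper_B_Weyl_spectrum A = Ea A"
proof -
  interpret normal_power A "op_adjoint A" n
    by unfold_locales (use assms op_adjoint_pair in \<open>auto simp: fun_eq_iff\<close>)
  show ?thesis
    \<comment> \<open>\<open>isolated_in\<close> includes membership in the approximate point
      spectrum, so the two lemmas are exactly the two inclusions.\<close>
    using upper_semi_B_Weyl_imp_Ea isolated_imp_upper_semi_B_Weyl
    unfolding upper_B_Weyl_spectrum_def by (auto simp: Ea_def isolated_in_def)
qed

end
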